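(* For any concave entropy function $S_K$ depending only on the (non-zero) spectrum of its input, the following four conditions are equivalent, each implying the other three. (i) The entropy $S_K$ is firmly subadditive; i.e. for any bipartite state $\rho_{ab}$ and any POVM $P_a$ on $a$, $$\chi_K(P_a,b)\leq S_K(a:b).$$ (ii) For any bipartite state $\rho_{ab}$ with $\rho_a=\mathrm{Tr}_b(\rho_{ab})$ and any POVM $P_a$ on $a$, $S_K$ satisfies $$\chi_K(P_a,b)\leq S_K(\rho_a).$$ (iii) For any tripartite pure state $\rho_{abc}$ and any rank-1 POVM $N_a$ on $a$, $\chi_K$ satisfies $$\chi_K(N_a,b)\leq \chi_K(N_a,bc).$$ (iv) For any quantum channel $\mathcal{E}$ and any ensemble of pure states $\{p_j,|\psi_j\rangle\langle\psi_j|\}$, $\chi_K$ satisfies $$\chi_K(\{p_j,\mathcal{E}(|\psi_j\rangle\langle\psi_j|)\})\leq \chi_K(\{p_j,|\psi_j\rangle\langle\psi_j|\}).$$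
   Context: A state (density operator) is a positive semidefinite operator of trace one on the Hilbert space of a quantum system. An entropy function $S_K$ assigns a real number $S_K(\rho)$ to each density operator $\rho$; examples are the von Neumann entropy $-\mathrm{Tr}(\rho\log\rho)$ and the quadratic entropy $1-\mathrm{Tr}(\rho^2)$. That $S_K$ depends only on the non-zero spectrum means $S_K(\rho)=S_K(\sigma)$ whenever $\rho$ and $\sigma$ (possibly on different spaces) have the same non-zero eigenvalues with multiplicity. Concave means $S_K(\sum_j p_j\rho_j)\ge\sum_j p_jS_K(\rho_j)$ for density operators $\rho_j$ on a common space and $0<p_j<1$ with $\sum_j p_j=1$. For a bipartite state $\rho_{ab}$, $\rho_a=\mathrm{Tr}_b(\rho_{ab})$ and $\rho_b=\mathrm{Tr}_a(\rho_{ab})$ are the partial traces, and $S_K(a:b)=S_K(\rho_a)+S_K(\rho_b)-S_K(\rho_{ab})$ is the generalized quantum mutual information. In the definition of firm subadditivity, the condition is required for all bipartite systems $ab$ of all dimensions, all $\rho_{ab}$ and all POVMs $P_a$ on $a$. A POVM $P_a=\{P_{aj}\}$ on $a$ is a collection of positive semidefinite operators on the Hilbert space of $a$ with $\sum_j P_{aj}=I_a$; it is a rank-1 POVM, denoted $N_a=\{N_{aj}\}$, if all its elements are rank-1 operators. A quantum channel is a completely positive trace-preserving linear map. For an ensemble $\{p_j,\rho_j\}$ (density operators $\rho_j$ on a common space with probabilities $p_j$), the Holevo quantity is $\chi_K(\{p_j,\rho_j\})=S_K(\sum_j p_j\rho_j)-\sum_j p_j S_K(\rho_j)$. For a bipartite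 state $\rho_{ab}$ and a POVM $P_a$ on $a$, $\chi_K(P_a,b)$ is the Holevo quantity of the ensemble $\{p_j,\rho_{bj}\}$ given by $p_j=\mathrm{Tr}(P_{aj}\rho_a)$ and $p_j\rho_{bj}=\mathrm{Tr}_a[(P_{aj}\otimes I_b)\rho_{ab}]$ (terms with $p_j=0$ omitted), i.e. $\chi_K(P_a,b)=S_K(\rho_b)-\sum_j p_jS_K(\rho_{bj})$. For a tripartite state $\rho_{abc}$, $\chi_K(P_a,bc)$ is defined in the same way with the joint system $bc$ in place of $b$, and $\chi_K(P_a,b)$ uses the reduced state $\rho_{ab}=\mathrm{Tr}_c(\rho_{abc})$.
   Formalization: The entropy function is additionally required to vanish on pure states; without this the claim fails, e.g. for the constant function −1, which is concave and spectral and satisfies (iii) and (iv) but violates (i) and (ii). *)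

theory Defs
  imports
    "Jordan_Normal_Form.Char_Poly"
    "Jordan_Normal_Form.DL_Rank"
    "Jordan_Normal_Form.Conjugate"
begin

text \<open>All systems are finite-dimensional: a system of dimension \<open>d\<close> has Hilbert space
  \<open>carrier_vec d\<close> over the complex numbers, and its operators are \<open>carrier_mat d d\<close>.
  The basis vector \<open>(i, j)\<close> of a tensor product of dimensions \<open>da\<close>, \<open>db\<close> has index
  \<open>i * db + j\<close>.  With this convention tensor products are strictly associative, so that an operator
  on a tripartite system is an operator on \<open>da * (db * dc)\<close> as well as on \<open>(da * db) * dc\<close>.\<close>

definition mat_trace :: "complex mat \<Rightarrow> complex" where
  "mat_trace A = (\<Sum>i<dim_row A. A $$ (i, i))"

definition mat_sum :: "nat \<Rightarrow> nat set \<Rightarrow> (nat \<Rightarrow> complex mat) \<Rightarrow> complex mat" where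
  "mat_sum d J A = mat d d (\<lambda>(r, s). \<Sum>j\<in>J. A j $$ (r, s))"

text \<open>The order on complex numbers is that of \<open>Complex_Order\<close>: \<open>0 \<le> z\<close> says that \<open>z\<close> is real and
  non-negative.  Hence the following implies that \<open>A\<close> is Hermitian.\<close>

definition psd :: "nat \<Rightarrow> complex mat \<Rightarrow> bool" where
  "psd d A \<longleftrightarrow> A \<in> carrier_mat d d \<and> (\<forall>v\<in>carrier_vec d. 0 \<le> (A *\<^sub>v v) \<bullet>c v)"

definition density_op :: "nat \<Rightarrow> complex mat \<Rightarrow> bool" where
  "density_op d \<rho> \<longleftrightarrow> psd d \<rho> \<and> mat_trace \<rho> = 1"

definition ketbra :: "complex vec \<Rightarrow> complex mat" where
  "ketbra \<psi> = mat (dim_vec \<psi>) (dim_vec \<psi>) (\<lambda>(r, s). \<psi> $ r * cnj (\<psi> $ s))"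

definition unit_ket :: "nat \<Rightarrow> complex vec \<Rightarrow> bool" where
  "unit_ket d \<psi> \<longleftrightarrow> \<psi> \<in> carrier_vec d \<and> \<psi> \<bullet>c \<psi> = 1"

definition pure_state :: "nat \<Rightarrow> complex mat \<Rightarrow> bool" where
  "pure_state d \<rho> \<longleftrightarrow> (\<exists>\<psi>. unit_ket d \<psi> \<and> \<rho> = ketbra \<psi>)"

definition tensor_mat :: "complex mat \<Rightarrow> complex mat \<Rightarrow> complex mat" where
  "tensor_mat A B = mat (dim_row A * dim_row B) (dim_col A * dim_col B)
     (\<lambda>(r, s). A $$ (r div dim_row B, s div dim_col B) * B $$ (r mod dim_row B, s mod dim_col B))"

text \<open>The partial traces of an operator on a tensor product of dimensions \<open>da\<close>, \<open>db\<close>: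
  \<open>ptrace_fst\<close> traces out the first factor, \<open>ptrace_snd\<close> the second.\<close>

definition ptrace_fst :: "nat \<Rightarrow> nat \<Rightarrow> complex mat \<Rightarrow> complex mat" where
  "ptrace_fst da db X = mat db db (\<lambda>(r, s). \<Sum>i<da. X $$ (i * db + r, i * db + s))"

definition ptrace_snd :: "nat \<Rightarrow> nat \<Rightarrow> complex mat \<Rightarrow> complex mat" where
  "ptrace_snd da db X = mat da da (\<lambda>(r, s). \<Sum>j<db. X $$ (r * db + j, s * db + j))"

definition povm :: "nat \<Rightarrow> nat \<Rightarrow> (nat \<Rightarrow> complex mat) \<Rightarrow> bool" where
  "povm d m P \<longleftrightarrow> (\<forall>j<m. psd d (P j)) \<and> mat_sum d {..<m} P = 1\<^sub>m d"

definition rank1_povm :: "nat \<Rightarrow> nat \<Rightarrow> (nat \<Rightarrow> complex mat) \<Rightarrow> bool" where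
  "rank1_povm d m N \<longleftrightarrow> povm d m N \<and> (\<forall>j<m. vec_space.rank d (N j) = 1)"

text \<open>The map \<open>id \<otimes> \<E>\<close> on a tensor product of dimensions \<open>k\<close>, \<open>n\<close> applies \<open>\<E>\<close>
  to each of the \<open>k * k\<close> blocks of size \<open>n\<close>.\<close>

definition mat_block :: "nat \<Rightarrow> complex mat \<Rightarrow> nat \<Rightarrow> nat \<Rightarrow> complex mat" where
  "mat_block n X i j = mat n n (\<lambda>(r, s). X $$ (i * n + r, j * n + s))"

definition ampliation ::
  "nat \<Rightarrow> nat \<Rightarrow> nat \<Rightarrow> (complex mat \<Rightarrow> complex mat) \<Rightarrow> complex mat \<Rightarrow> complex mat" where
  "ampliation k n m \<E> X = mat (k * m) (k * m)
     (\<lambda>(r, s). \<E> (mat_block n X (r div m) (s div m)) $$ (r mod m, s mod m))"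

definition linear_on_mats :: "nat \<Rightarrow> nat \<Rightarrow> (complex mat \<Rightarrow> complex mat) \<Rightarrow> bool" where
  "linear_on_mats n m \<E> \<longleftrightarrow>
     (\<forall>A\<in>carrier_mat n n. \<E> A \<in> carrier_mat m m) \<and>
     (\<forall>A\<in>carrier_mat n n. \<forall>B\<in>carrier_mat n n. \<E> (A + B) = \<E> A + \<E> B) \<and>
     (\<forall>c. \<forall>A\<in>carrier_mat n n. \<E> (c \<cdot>\<^sub>m A) = c \<cdot>\<^sub>m \<E> A)"

definition completely_positive :: "nat \<Rightarrow> nat \<Rightarrow> (complex mat \<Rightarrow> complex mat) \<Rightarrow> bool" where
  "completely_positive n m \<E> \<longleftrightarrow>
     (\<forall>k X. psd (k * n) X \<longrightarrow> psd (k * m) (ampliation k n m \<E> X))"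

definition trace_preserving :: "nat \<Rightarrow> (complex mat \<Rightarrow> complex mat) \<Rightarrow> bool" where
  "trace_preserving n \<E> \<longleftrightarrow> (\<forall>A\<in>carrier_mat n n. mat_trace (\<E> A) = mat_trace A)"

definition quantum_channel :: "nat \<Rightarrow> nat \<Rightarrow> (complex mat \<Rightarrow> complex mat) \<Rightarrow> bool" where
  "quantum_channel n m \<E> \<longleftrightarrow>
     linear_on_mats n m \<E> \<and> completely_positive n m \<E> \<and> trace_preserving n \<E>"

definition prob_weights :: "nat \<Rightarrow> (nat \<Rightarrow> real) \<Rightarrow> bool" where
  "prob_weights m p \<longleftrightarrow> (\<forall>j<m. 0 \<le> p j) \<and> (\<Sum>j<m. p j) = 1"

text \<open>An entropy function is a map \<open>S :: complex mat \<Rightarrow> real\<close>; only its values on density operators,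
  of any dimension, matter.

  Pure states are required to have zero entropy.  This normalisation is indispensable: the constant
  function \<open>-1\<close> is concave, depends only on the spectrum and satisfies the Holevo-quantity
  inequalities for pure tripartite states and for channels (both sides are \<open>0\<close>), but it is not
  firmly subadditive.  No other property, such as non-negativity, is imposed.\<close>

definition entropy_function :: "(complex mat \<Rightarrow> real) \<Rightarrow> bool" where
  "entropy_function S \<longleftrightarrow> (\<forall>d \<rho>. pure_state d \<rho> \<longrightarrow> S \<rho> = 0)"

text \<open>For the Hermitian matrices at hand, the multiplicity of an eigenvalue is its multiplicity as a
  root of the characteristic polynomial, which is \<open>0\<close> for non-eigenvalues.\<close>

definition same_nonzero_spectrum :: "complex mat \<Rightarrow> complex mat \<Rightarrow> bool" where
  "same_nonzero_spectrum A B \<longleftrightarrow>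
     (\<forall>x::complex. x \<noteq> 0 \<longrightarrow> Polynomial.order x (char_poly A) = Polynomial.order x (char_poly B))"

definition depends_on_nonzero_spectrum :: "(complex mat \<Rightarrow> real) \<Rightarrow> bool" where
  "depends_on_nonzero_spectrum S \<longleftrightarrow>
     (\<forall>d d' \<rho> \<sigma>. density_op d \<rho> \<and> density_op d' \<sigma> \<and> same_nonzero_spectrum \<rho> \<sigma> \<longrightarrow> S \<rho> = S \<sigma>)"

definition concave_entropy :: "(complex mat \<Rightarrow> real) \<Rightarrow> bool" where
  "concave_entropy S \<longleftrightarrow>
     (\<forall>d m p \<rho>. (\<forall>j<m. density_op d (\<rho> j) \<and> 0 < p j \<and> p j < 1) \<and> (\<Sum>j<m. p j) = 1 \<longrightarrow>
        S (mat_sum d {..<m} (\<lambda>j. complex_of_real (p j) \<cdot>\<^sub>m \<rho> j)) \<ge> (\<Sum>j<m. p j * S (\<rho> j)))"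

text \<open>The Holevo quantity of the ensemble of states \<open>\<rho> j\<close> of a \<open>d\<close>-dimensional system with
  probabilities \<open>p j\<close>, where \<open>j\<close> ranges over the finite set \<open>J\<close>.\<close>

definition holevo ::
  "(complex mat \<Rightarrow> real) \<Rightarrow> nat \<Rightarrow> nat set \<Rightarrow> (nat \<Rightarrow> real) \<Rightarrow> (nat \<Rightarrow> complex mat) \<Rightarrow> real" where
  "holevo S d J p \<rho> =
     S (mat_sum d J (\<lambda>j. complex_of_real (p j) \<cdot>\<^sub>m \<rho> j)) - (\<Sum>j\<in>J. p j * S (\<rho> j))"

text \<open>Outcome probability and conditional state on the second factor when the effect \<open>Q\<close> is obtained
  in a measurement of the first factor.  The probability is real, since \<open>Q\<close> and the state are
  positive semidefinite.\<close>

definition outcome_prob :: "nat \<Rightarrow> nat \<Rightarrow> complex mat \<Rightarrow> complex mat \<Rightarrow> real" where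
  "outcome_prob da db Q \<rho> = Re (mat_trace (Q * ptrace_snd da db \<rho>))"

definition cond_state :: "nat \<Rightarrow> nat \<Rightarrow> complex mat \<Rightarrow> complex mat \<Rightarrow> complex mat" where
  "cond_state da db Q \<rho> =
     complex_of_real (1 / outcome_prob da db Q \<rho>) \<cdot>\<^sub>m
       ptrace_fst da db (tensor_mat Q (1\<^sub>m db) * \<rho>)"

definition chi_povm ::
  "(complex mat \<Rightarrow> real) \<Rightarrow> nat \<Rightarrow> nat \<Rightarrow> nat \<Rightarrow> (nat \<Rightarrow> complex mat) \<Rightarrow> complex mat \<Rightarrow> real" where
  "chi_povm S da db m P \<rho> =
     holevo S db {j. j < m \<and> outcome_prob da db (P j) \<rho> \<noteq> 0}
       (\<lambda>j. outcome_prob da db (P j) \<rho>) (\<lambda>j. cond_state da db (P j) \<rho>)"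

definition mutual_info :: "(complex mat \<Rightarrow> real) \<Rightarrow> nat \<Rightarrow> nat \<Rightarrow> complex mat \<Rightarrow> real" where
  "mutual_info S da db \<rho> = S (ptrace_snd da db \<rho>) + S (ptrace_fst da db \<rho>) - S \<rho>"

definition firmly_subadditive :: "(complex mat \<Rightarrow> real) \<Rightarrow> bool" where
  "firmly_subadditive S \<longleftrightarrow>
     (\<forall>da db m \<rho> P. density_op (da * db) \<rho> \<and> povm da m P \<longrightarrow>
        chi_povm S da db m P \<rho> \<le> mutual_info S da db \<rho>)"

definition holevo_le_measured_entropy :: "(complex mat \<Rightarrow> real) \<Rightarrow> bool" where
  "holevo_le_measured_entropy S \<longleftrightarrow>
     (\<forall>da db m \<rho> P. density_op (da * db) \<rho> \<and> povm da m P \<longrightarrow>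
        chi_povm S da db m P \<rho> \<le> S (ptrace_snd da db \<rho>))"

definition holevo_tripartite_monotone :: "(complex mat \<Rightarrow> real) \<Rightarrow> bool" where
  "holevo_tripartite_monotone S \<longleftrightarrow>
     (\<forall>da db dc m \<rho> N. pure_state (da * db * dc) \<rho> \<and> rank1_povm da m N \<longrightarrow>
        chi_povm S da db m N (ptrace_snd (da * db) dc \<rho>) \<le> chi_povm S da (db * dc) m N \<rho>)"

definition holevo_channel_monotone :: "(complex mat \<Rightarrow> real) \<Rightarrow> bool" where
  "holevo_channel_monotone S \<longleftrightarrow>
     (\<forall>d d' m \<E> p \<psi>.
        quantum_channel d d' \<E> \<and> prob_weights m p \<and> (\<forall>j<m. unit_ket d (\<psi> j)) \<longrightarrow>
        holevo S d' {..<m} p (\<lambda>j. \<E> (ketbra (\<psi> j))) \<le> holevo S d {..<m} p (\<lambda>j. ketbra (\<psi> j)))"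

end

theory Submission
  imports Defs "Jordan_Normal_Form.DL_Rank_Submatrix"
begin

text \<open>Factor a positive semidefinite operator as \<open>f f\<^sup>\<dagger>\<close>.  The operators \<open>f f\<^sup>\<dagger>\<close> and \<open>f\<^sup>\<dagger> f\<close> have the same
  non-zero spectrum, hence the same entropy; read on a purification, this says that complementary
  marginals of a pure state have equal entropies.  By concavity, refining a POVM to rank-1 elements
  can only increase \<open>\<chi>\<close>, so it suffices to consider rank-1 POVMs.  For these the conditional states of
  \<open>b\<close> and of the purifying system \<open>c\<close> have equal entropies, so exchanging \<open>b\<close> and \<open>c\<close> turns (i) into (ii);
  moreover the conditional states of \<open>bc\<close> are pure, so that \<open>\<chi>(N\<^sub>a, bc) = S(\<rho>\<^sub>a)\<close>, which turns (ii) into (iii).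
  The partial trace over \<open>c\<close> is a channel, so (iv) implies (iii).  Conversely, (ii) gives (iv)
  when applied to the image under \<open>id \<otimes> \<E>\<close> of \<open>\<Sum>\<^sub>j \<surd>p\<^sub>j |j\<rangle>|\<psi>\<^sub>j\<rangle>\<close>, measured in the standard basis of the
  first factor: there \<open>\<rho>\<^sub>a\<close> is the Gram matrix of the vectors \<open>\<surd>p\<^sub>j |\<psi>\<^sub>j\<rangle>\<close>.\<close>

section \<open>Positive semidefinite matrices as Gram matrices\<close>

text \<open>Sylvester's determinant identity. Both sides are computed from the determinant of one
  block matrix with diagonal blocks \<open>x I\<close> and \<open>I\<close> and off-diagonal blocks
  \<open>A\<close> and \<open>B\<close>, eliminated in two ways. The powers of the indeterminate
  compensate for the different sizes.\<close>

lemma char_poly_mult_commute: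
  fixes A B :: "'a :: field mat"
  assumes A: "A \<in> carrier_mat n m" and B: "B \<in> carrier_mat m n"
  shows "[:0, 1:] ^ m * char_poly (A * B) = [:0, 1:] ^ n * char_poly (B * A)"
proof -
  define x :: "'a poly" where "x = [:0, 1:]"
  interpret c: ring_hom "\<lambda>a :: 'a. [:a:]"
    by unfold_locales auto
  define A' where "A' = map_mat (\<lambda>a. [:a:]) A"
  define B' where "B' = map_mat (\<lambda>a. [:a:]) B"
  have A': "A' \<in> carrier_mat n m" and B': "B' \<in> carrier_mat m n"
    using A B by (auto simp: A'_def B'_def)
  have AB: "A' * B' = map_mat (\<lambda>a. [:a:]) (A * B)"
    unfolding A'_def B'_def by (rule c.mat_hom_mult[OF A B, symmetric])
  have BA: "B' * A' = map_mat (\<lambda>a. [:a:]) (B * A)"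
    unfolding A'_def B'_def by (rule c.mat_hom_mult[OF B A, symmetric])
  have cpAB: "x \<cdot>\<^sub>m 1\<^sub>m n - A' * B' = char_poly_matrix (A * B)"
    using A B unfolding char_poly_matrix_def AB x_def by (intro eq_matI) auto
  have cpBA: "x \<cdot>\<^sub>m 1\<^sub>m m - B' * A' = char_poly_matrix (B * A)"
    using A B unfolding char_poly_matrix_def BA x_def by (intro eq_matI) auto
  \<comment> \<open>Multiplying \<open>X\<close> by \<open>L\<close> on the right or by \<open>R\<close> on the left makes it block triangular.\<close>
  define X where "X = four_block_mat (x \<cdot>\<^sub>m 1\<^sub>m n) A' B' (1\<^sub>m m)"
  have X: "X \<in> carrier_mat (n + m) (n + m)" unfolding X_def using A' B' by auto
  define L where "L = four_block_mat (1\<^sub>m n) (0\<^sub>m n m) (- B') (1\<^sub>m m)"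
  define R where "R = four_block_mat (1\<^sub>m n) (0\<^sub>m n m) (- B') (x \<cdot>\<^sub>m 1\<^sub>m m)"
  have L: "L \<in> carrier_mat (n + m) (n + m)" and R: "R \<in> carrier_mat (n + m) (n + m)"
    unfolding L_def R_def using B' by auto
  have mB: "- B' \<in> carrier_mat m n" using B' by auto
  have "X * L = four_block_mat (x \<cdot>\<^sub>m 1\<^sub>m n - A' * B') A' (0\<^sub>m m n) (1\<^sub>m m)"
    unfolding X_def L_def
    by (subst mult_four_block_mat[OF _ A' B' _ _ _ mB]) (use A' B' in auto)
  then have 1: "det (X * L) = char_poly (A * B)"
    using A' B' A B
    by (simp add: det_four_block_mat_lower_left_zero[OF _ A' refl one_carrier_mat] char_poly_def cpAB)
  have "R * X = four_block_mat (x \<cdot>\<^sub>m 1\<^sub>m n) A' (0\<^sub>m m n) (x \<cdot>\<^sub>m 1\<^sub>m m - B' * A')"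
    unfolding X_def R_def
    by (subst mult_four_block_mat[OF _ _ mB _ _ A' B']) (use A' B' in auto)
  then have 2: "det (R * X) = x ^ n * char_poly (B * A)"
    using A B by (simp add: det_four_block_mat_lower_left_zero[OF _ A' refl] char_poly_def cpBA)
  have "det L = 1" "det R = x ^ m" unfolding L_def R_def
    using mB by (simp_all add: det_four_block_mat_upper_right_zero[where n = n and m = m])
  then show ?thesis using 1 2 det_mult[OF X L] det_mult[OF R X] by (simp add: x_def)
qed

text \<open>The correction factors in Sylvester's identity are powers of the indeterminate, whose
  only root is 0, so they do not affect the order at a non-zero \<open>x\<close>.\<close>

lemma order_char_poly_mult_commute:
  fixes A B :: "'a :: field mat"
  assumes A: "A \<in> carrier_mat n m" and B: "B \<in> carrier_mat m n" and "x \<noteq> 0"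
  shows "Polynomial.order x (char_poly (A * B)) = Polynomial.order x (char_poly (B * A))"
proof -
  have x: "Polynomial.order x ([:0, 1:] ^ k) = 0" for k
    using \<open>x \<noteq> 0\<close> by (intro order_0I) (simp add: poly_power)
  have "char_poly (A * B) \<noteq> 0" "char_poly (B * A) \<noteq> 0"
    using degree_monic_char_poly[of "A * B" n] degree_monic_char_poly[of "B * A" m] A B by auto
  then have "Polynomial.order x ([:0, 1:] ^ m * char_poly (A * B)) = Polynomial.order x (char_poly (A * B))"
     "Polynomial.order x ([:0, 1:] ^ n * char_poly (B * A)) = Polynomial.order x (char_poly (B * A))"
    by (subst order_mult, auto simp: x)+
  then show ?thesis using char_poly_mult_commute[OF A B] by simp
qed

text \<open>This is \<open>F F^*\<close> for the \<open>n\<close> by \<open>m\<close> matrix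
  \<open>F\<close> with entries \<open>f r k\<close>. Since the factor is a function, the
  complementary product is written by exchanging its arguments, and padding or reindexing the
  columns needs no matrix operations.\<close>

definition gram :: "nat \<Rightarrow> nat \<Rightarrow> (nat \<Rightarrow> nat \<Rightarrow> complex) \<Rightarrow> complex mat" where
  "gram n m f = mat n n (\<lambda>(r, s). \<Sum>k<m. f r k * cnj (f s k))"

lemma gram_carrier [simp]: "gram n m f \<in> carrier_mat n n"
  and dim_gram [simp]: "dim_row (gram n m f) = n" "dim_col (gram n m f) = n"
  and index_gram [simp]: "r < n \<Longrightarrow> s < n \<Longrightarrow> gram n m f $$ (r, s) = (\<Sum>k<m. f r k * cnj (f s k))"
  by (auto simp: gram_def)

lemma gram_cong:
  "(\<And>r k. r < n \<Longrightarrow> k < m \<Longrightarrow> f r k = g r k) \<Longrightarrow> gram n m f = gram n m g"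
  by (intro eq_matI) auto

text \<open>Exchanging the arguments of \<open>f\<close> gives the transpose of
  \<open>F^* F\<close>, because the conjugate stays on the second factor. Transposition preserves
  the characteristic polynomial, so the comparison of \<open>A * B\<close> with \<open>B * A\<close>
  applies.\<close>

lemma same_nonzero_spectrum_gram:
  "same_nonzero_spectrum (gram n m f) (gram m n (\<lambda>k r. f r k))"
proof -
  define A where "A = mat n m (\<lambda>(r, k). f r k)"
  define B where "B = mat m n (\<lambda>(k, r). cnj (f r k))"
  have A: "A \<in> carrier_mat n m" and B: "B \<in> carrier_mat m n" by (auto simp: A_def B_def)
  have "gram n m f = A * B"
    by (intro eq_matI) (auto simp: A_def B_def scalar_prod_def lessThan_atLeast0)
  moreover have "gram m n (\<lambda>k r. f r k) = transpose_mat (B * A)"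
    by (intro eq_matI) (auto simp: A_def B_def scalar_prod_def lessThan_atLeast0 mult.commute)
  moreover have "char_poly (transpose_mat (B * A)) = char_poly (B * A)"
    using A B by (intro char_poly_transpose_mat[where n = m]) auto
  ultimately show ?thesis
    unfolding same_nonzero_spectrum_def by (auto intro!: order_char_poly_mult_commute[OF A B])
qed

text \<open>Cholesky: split off the last row and column and apply the induction hypothesis to the Schur
  complement.\<close>

lemma positive_form_imp_sum_squares:
  fixes A :: "nat \<Rightarrow> nat \<Rightarrow> complex"
  assumes "\<And>v. 0 \<le> (\<Sum>r<n. \<Sum>s<n. cnj (v r) * A r s * v s)"
  shows "\<exists>f. \<forall>r<n. \<forall>s<n. A r s = (\<Sum>k<n. f r k * cnj (f s k))"
  using assms
proof (induction n arbitrary: A)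
  case 0
  then show ?case by auto
next
  case (Suc n)
  define a where "a = A n n"
  have form: "0 \<le> (\<Sum>r<n. \<Sum>s<n. cnj (v r) * A r s * v s) + (\<Sum>r<n. cnj (v r) * A r n) * t
      + cnj t * (\<Sum>s<n. A n s * v s) + cnj t * a * t" for v t
  proof -
    have "0 \<le> (\<Sum>r<Suc n. \<Sum>s<Suc n. cnj ((v(n := t)) r) * A r s * (v(n := t)) s)"
      by (rule Suc.prems)
    also have "\<dots> = (\<Sum>r<n. \<Sum>s<n. cnj (v r) * A r s * v s) + (\<Sum>r<n. cnj (v r) * A r n) * t
      + cnj t * (\<Sum>s<n. A n s * v s) + cnj t * a * t"
      by (simp add: sum.distrib sum_distrib_left sum_distrib_right a_def algebra_simps)
    finally show ?thesis .
  qed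
  \<comment> \<open>The form on vectors supported on the coordinates \<open>r\<close> and
    \<open>n\<close>, that is, a principal 2 by 2 block.\<close>
  have two: "0 \<le> cnj u * A r r * u + cnj u * A r n * t + cnj t * A n r * u + cnj t * a * t"
    if "r < n" for r u t
  proof -
    define w where "w s = (if s = r then u else 0)" for s
    have w: "(\<Sum>s<n. g s * w s) = g r * u" "(\<Sum>s<n. cnj (w s) * g s) = cnj u * g r" for g
      using that by (simp_all add: w_def if_distrib if_distribR cong: if_cong)
    have "(\<Sum>q<n. \<Sum>s<n. cnj (w q) * A q s * w s) = cnj u * A r r * u"
      by (simp only: w(1)) (simp only: mult.assoc w(2))
    then show ?thesis using form[of w t] unfolding w by (simp add: algebra_simps)
  qed
  have a0: "0 \<le> a" using form[of "\<lambda>_. 0" 1] by simp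
  then have a_real: "cnj a = a" by (simp add: less_eq_complex_def complex_eq_iff)
  have d0: "0 \<le> A r r" if "r < n" for r using two[OF that, of 1 0] by simp
  \<comment> \<open>The values of the form are real: \<open>t = 1\<close> compares the imaginary
    parts of the two off-diagonal entries, \<open>t = \<i>\<close> their real parts.\<close>
  have herm: "A n r = cnj (A r n)" if "r < n" for r
    using two[OF that, of 1 1] two[OF that, of 1 \<i>] d0[OF that] a0
    by (auto simp: less_eq_complex_def complex_eq_iff)
  show ?case
  proof (cases "a = 0")
    case True
    have z: "A r n = 0" if "r < n" for r
    proof (rule ccontr)
      assume nz: "A r n \<noteq> 0"
      \<comment> \<open>With zero pivot the form at \<open>(1, t)\<close> is affine in the real part
        of \<open>A r n * t\<close>. This \<open>t\<close> brings its value down to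
        \<open>- A r r - 2\<close>, which is negative.\<close>
      define t where "t = - complex_of_real (Re (A r r) + 1) / A r n"
      have rr: "A r r = of_real (Re (A r r))"
        using d0[OF that] by (auto simp: less_eq_complex_def complex_eq_iff)
      have tt: "A r n * t = - of_real (Re (A r r) + 1)" using nz by (simp add: t_def)
      then have "cnj t * cnj (A r n) = - of_real (Re (A r r) + 1)"
        by (metis complex_cnj_complex_of_real complex_cnj_minus complex_cnj_mult mult.commute)
      then have "A r r \<le> - 2"
        using two[OF that, of 1 t] tt herm[OF that] rr True by simp
      then have "Re (A r r) \<le> - 2" by (simp add: less_eq_complex_def)
      then show False using d0[OF that] by (simp add: less_eq_complex_def)
    qed
    have "0 \<le> (\<Sum>r<n. \<Sum>s<n. cnj (v r) * A r s * v s)" for v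
      using form[of v 0] by simp
    from Suc.IH[OF this] obtain f where
      f: "A r s = (\<Sum>k<n. f r k * cnj (f s k))" if "r < n" "s < n" for r s by blast
    \<comment> \<open>The last row and column vanish here, so the smaller factor is padded with
      zeros.\<close>
    define g where "g r k = (if r < n \<and> k < n then f r k else 0)" for r k
    have "A r s = (\<Sum>k<Suc n. g r k * cnj (g s k))" if "r < Suc n" "s < Suc n" for r s
      using that True z herm f by (auto simp: g_def less_Suc_eq a_def)
    then show ?thesis by blast
  next
    case False
    have "0 \<le> (\<Sum>r<n. \<Sum>s<n. cnj (v r) * (A r s - A r n * A n s / a) * v s)" for v
    proof -
      define b where "b = (\<Sum>s<n. A n s * v s)"
      have cb: "(\<Sum>r<n. cnj (v r) * A r n) = cnj b"
        by (simp add: b_def herm mult.commute)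
      have "(\<Sum>r<n. \<Sum>s<n. cnj (v r) * (A r s - A r n * A n s / a) * v s) =
         (\<Sum>r<n. \<Sum>s<n. cnj (v r) * A r s * v s) - (\<Sum>r<n. \<Sum>s<n. (cnj (v r) * A r n) * (A n s * v s)) / a"
        by (simp add: algebra_simps sum_subtractf sum_divide_distrib)
      also have "(\<Sum>r<n. \<Sum>s<n. (cnj (v r) * A r n) * (A n s * v s)) = cnj b * b"
        by (simp only: sum_product[symmetric] cb b_def[symmetric])
      \<comment> \<open>Completing the square: the last coordinate \<open>- b / a\<close> minimises
        the form for fixed \<open>v\<close>, and the minimum is the form of the Schur
        complement.\<close>
      also have "(\<Sum>r<n. \<Sum>s<n. cnj (v r) * A r s * v s) - cnj b * b / a =
         (\<Sum>r<n. \<Sum>s<n. cnj (v r) * A r s * v s) + cnj b * (- b / a)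
           + cnj (- b / a) * b + cnj (- b / a) * a * (- b / a)"
        using False by (simp add: a_real field_simps)
      also have "0 \<le> \<dots>" using form[of v "- b / a"] by (simp add: cb b_def[symmetric])
      finally show ?thesis .
    qed
    from Suc.IH[OF this] obtain f where
      f: "A r s - A r n * A n s / a = (\<Sum>k<n. f r k * cnj (f s k))" if "r < n" "s < n" for r s by blast
    define q where "q = complex_of_real (sqrt (Re a))"
    have qq: "q * q = a" "cnj q = q" and q0: "q \<noteq> 0"
      using a0 False by (auto simp: q_def less_eq_complex_def complex_eq_iff)
    \<comment> \<open>The new column contributes exactly the rank-1 term removed in the Schur
      complement. The old columns are zero in row \<open>n\<close>, where the new one has the entry
      \<open>a / q = q\<close>.\<close>
    define g where "g r k = (if k = n then A r n / q else if r < n then f r k else 0)" for r k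
    have "A r s = (\<Sum>k<Suc n. g r k * cnj (g s k))" if "r < Suc n" "s < Suc n" for r s
    proof -
      have ca: "cnj (A n n) = A n n" using a_real by (simp add: a_def)
      have hs: "cnj (A s n) = A n s" using that(2) herm[of s] ca by (auto simp: less_Suc_eq)
      have last: "g r n * cnj (g s n) = A r n * A n s / a"
        using q0 qq by (simp add: g_def hs)
      show ?thesis
      proof (cases "r < n \<and> s < n")
        case True
        then have "(\<Sum>k<n. g r k * cnj (g s k)) = A r s - A r n * A n s / a"
          using f by (simp add: g_def)
        then show ?thesis using last by simp
      next
        case False
        then have "(\<Sum>k<n. g r k * cnj (g s k)) = 0" by (auto simp: g_def)
        then show ?thesis using last that False \<open>a \<noteq> 0\<close> by (auto simp: less_Suc_eq a_def)
      qed
    qed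
    then show ?thesis by blast
  qed
qed

lemma mat_quadratic_form:
  assumes "A \<in> carrier_mat d d" "v \<in> carrier_vec d"
  shows "(A *\<^sub>v v) \<bullet>c v = (\<Sum>r<d. \<Sum>s<d. cnj (v $ r) * A $$ (r, s) * v $ s)"
  using assms by (auto simp: scalar_prod_def lessThan_atLeast0 sum_distrib_right sum_distrib_left ac_simps intro!: sum.cong)

lemma psd_imp_gram:
  assumes "psd d A"
  shows "\<exists>f. A = gram d d f"
proof -
  have A: "A \<in> carrier_mat d d" using assms by (simp add: psd_def)
  have "0 \<le> (\<Sum>r<d. \<Sum>s<d. cnj (v r) * A $$ (r, s) * v s)" for v
    using assms[unfolded psd_def, THEN conjunct2, rule_format, of "vec d v"]
    by (simp add: mat_quadratic_form[OF A])
  from positive_form_imp_sum_squares[OF this] obtain f where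
    "\<forall>r<d. \<forall>s<d. A $$ (r, s) = (\<Sum>k<d. f r k * cnj (f s k))" by blast
  then have "A = gram d d f" using A by (intro eq_matI) auto
  then show ?thesis by blast
qed

text \<open>The quadratic form of \<open>F F^*\<close> at \<open>v\<close> is the squared norm of
  \<open>F^* v\<close>; this appears once the sum over the columns \<open>k\<close> is moved
  outermost.\<close>

lemma psd_gram [simp]: "psd d (gram d m f)"
  unfolding psd_def
proof (intro conjI ballI)
  fix v :: "complex vec" assume v: "v \<in> carrier_vec d"
  have sq: "0 \<le> z * cnj z" for z by (simp add: less_eq_complex_def)
  have "(gram d m f *\<^sub>v v) \<bullet>c v = (\<Sum>r<d. \<Sum>s<d. \<Sum>k<m. (cnj (v $ r) * f r k) * (cnj (f s k) * v $ s))"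
    by (simp add: mat_quadratic_form[OF gram_carrier v] sum_distrib_left sum_distrib_right ac_simps)
  also have "\<dots> = (\<Sum>k<m. \<Sum>r<d. \<Sum>s<d. (cnj (v $ r) * f r k) * (cnj (f s k) * v $ s))"
    by (subst sum.swap[where B = "{..<m}"], subst sum.swap[where B = "{..<m}"]) simp
  also have "\<dots> = (\<Sum>k<m. (\<Sum>r<d. cnj (v $ r) * f r k) * cnj (\<Sum>r<d. cnj (v $ r) * f r k))"
  proof -
    have "cnj (\<Sum>r<d. cnj (v $ r) * f r k) = (\<Sum>r<d. cnj (f r k) * v $ r)" for k
      by (simp add: mult.commute)
    then show ?thesis by (simp only: sum_product)
  qed
  also have "0 \<le> \<dots>" by (intro sum_nonneg) (simp only: sq)
  finally show "0 \<le> (gram d m f *\<^sub>v v) \<bullet>c v" .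
qed simp

section \<open>Product indices, finite sums of matrices and traces\<close>

lemma sum_lessThan_mult:
  fixes f :: "nat \<Rightarrow> 'a :: comm_monoid_add"
  shows "(\<Sum>x<a * b. f x) = (\<Sum>i<a. \<Sum>j<b. f (i * b + j))"
proof (induction a)
  case (Suc a)
  have "(\<Sum>x<Suc a * b. f x) = (\<Sum>x<a * b. f x) + (\<Sum>x\<in>{a * b..<a * b + b}. f x)"
    by (simp add: lessThan_atLeast0 sum.atLeastLessThan_concat add.commute)
  also have "(\<Sum>x\<in>{a * b..<a * b + b}. f x) = (\<Sum>j<b. f (a * b + j))"
    using sum.shift_bounds_nat_ivl[of f 0 "a * b" b] by (simp add: lessThan_atLeast0 add.commute)
  finally show ?case using Suc.IH by simp
qed simp

lemma mult_add_less_mult: "i < a \<Longrightarrow> j < b \<Longrightarrow> i * b + j < a * (b :: nat)"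
proof -
  assume "i < a" "j < b"
  then have "i * b + j < Suc i * b" by simp
  also have "\<dots> \<le> a * b" using \<open>i < a\<close> by (intro mult_right_mono) auto
  finally show ?thesis .
qed

lemma mat_sum_carrier [simp]: "mat_sum d J A \<in> carrier_mat d d"
  and dim_mat_sum [simp]: "dim_row (mat_sum d J A) = d" "dim_col (mat_sum d J A) = d"
  and index_mat_sum [simp]: "r < d \<Longrightarrow> s < d \<Longrightarrow> mat_sum d J A $$ (r, s) = (\<Sum>j\<in>J. A j $$ (r, s))"
  by (auto simp: mat_sum_def)

lemma mat_sum_cong:
  "J = J' \<Longrightarrow> (\<And>j. j \<in> J' \<Longrightarrow> A j = B j) \<Longrightarrow> mat_sum d J A = mat_sum d J' B"
  by (intro eq_matI) auto

lemma dim_ketbra [simp]: "dim_row (ketbra v) = dim_vec v" "dim_col (ketbra v) = dim_vec v"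
  and index_ketbra [simp]:
    "r < dim_vec v \<Longrightarrow> s < dim_vec v \<Longrightarrow> ketbra v $$ (r, s) = v $ r * cnj (v $ s)"
  by (auto simp: ketbra_def)

lemma ketbra_carrier [simp]: "v \<in> carrier_vec d \<Longrightarrow> ketbra v \<in> carrier_mat d d"
  by (auto simp: ketbra_def)

lemma ketbra_eq_gram: "v \<in> carrier_vec d \<Longrightarrow> ketbra v = gram d 1 (\<lambda>r _. v $ r)"
  by (intro eq_matI) auto

lemma gram_one_eq_ketbra: "gram d 1 f = ketbra (vec d (\<lambda>r. f r 0))"
  by (intro eq_matI) auto

lemma gram_eq_sum_ketbra: "gram d m f = mat_sum d {..<m} (\<lambda>k. ketbra (vec d (\<lambda>r. f r k)))"
  by (intro eq_matI) auto

lemma psd_carrier: "psd d A \<Longrightarrow> A \<in> carrier_mat d d"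
  by (simp add: psd_def)

lemma psd_ketbra: "v \<in> carrier_vec d \<Longrightarrow> psd d (ketbra v)"
  by (simp add: ketbra_eq_gram)

lemma psd_add:
  assumes "psd d A" "psd d B"
  shows "psd d (A + B)"
proof -
  note A = psd_carrier[OF assms(1)] and B = psd_carrier[OF assms(2)]
  have "((A + B) *\<^sub>v v) \<bullet>c v = (A *\<^sub>v v) \<bullet>c v + (B *\<^sub>v v) \<bullet>c v" if "v \<in> carrier_vec d" for v
    unfolding mat_quadratic_form[OF A that] mat_quadratic_form[OF B that]
      mat_quadratic_form[OF add_carrier_mat[OF B] that]
    using A B by (simp add: algebra_simps sum.distrib)
  then show ?thesis using assms by (auto simp: psd_def)
qed

lemma psd_zero [simp]: "psd d (0\<^sub>m d d)"
proof -
  have "0\<^sub>m d d = gram d 0 (\<lambda>_ _. 0)" by (intro eq_matI) auto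
  then show ?thesis by simp
qed

lemma mat_sum_empty: "mat_sum d {} A = 0\<^sub>m d d"
  by (intro eq_matI) auto

lemma mat_sum_insert:
  "finite J \<Longrightarrow> j \<notin> J \<Longrightarrow> A j \<in> carrier_mat d d \<Longrightarrow> mat_sum d (insert j J) A = A j + mat_sum d J A"
  by (intro eq_matI) auto

lemma psd_mat_sum:
  assumes "\<And>j. j \<in> J \<Longrightarrow> psd d (A j)"
  shows "psd d (mat_sum d J A)"
proof (cases "finite J")
  case True
  then show ?thesis using assms
    by (induction J) (auto simp: mat_sum_empty mat_sum_insert psd_carrier intro: psd_add)
next
  case False
  then have "mat_sum d J A = 0\<^sub>m d d" by (intro eq_matI) auto
  then show ?thesis by simp
qed

lemma smult_gram:
  assumes "0 \<le> c"
  shows "complex_of_real c \<cdot>\<^sub>m gram n m f = gram n m (\<lambda>r k. complex_of_real (sqrt c) * f r k)"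
proof -
  have "complex_of_real (sqrt c) * complex_of_real (sqrt c) = complex_of_real c"
    using assms by (simp flip: of_real_mult)
  then have "complex_of_real (sqrt c) * x * (complex_of_real (sqrt c) * y) = complex_of_real c * (x * y)" for x y
    by (metis mult.assoc mult.left_commute)
  note eq = this
  show ?thesis by (intro eq_matI) (auto simp: sum_distrib_left eq)
qed

lemma psd_smult: "psd d A \<Longrightarrow> 0 \<le> c \<Longrightarrow> psd d (complex_of_real c \<cdot>\<^sub>m A)"
  using psd_imp_gram[of d A] by (auto simp: smult_gram)

lemma mat_trace_smult [simp]: "mat_trace (c \<cdot>\<^sub>m A) = c * mat_trace A" if "A \<in> carrier_mat d d"
  using that by (simp add: mat_trace_def sum_distrib_left)

lemma mat_trace_add:
  "A \<in> carrier_mat d d \<Longrightarrow> B \<in> carrier_mat d d \<Longrightarrow> mat_trace (A + B) = mat_trace A + mat_trace B"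
  by (simp add: mat_trace_def sum.distrib)

lemma mat_trace_mat_sum:
  assumes "\<And>j. j \<in> J \<Longrightarrow> A j \<in> carrier_mat d d"
  shows "mat_trace (mat_sum d J A) = (\<Sum>j\<in>J. mat_trace (A j))"
proof -
  have "(\<Sum>j\<in>J. mat_trace (A j)) = (\<Sum>j\<in>J. \<Sum>i<d. A j $$ (i, i))"
    using assms by (intro sum.cong) (auto simp: mat_trace_def)
  then show ?thesis by (simp add: mat_trace_def sum.swap[of _ J])
qed

lemma mat_trace_gram: "mat_trace (gram n m f) = complex_of_real (\<Sum>r<n. \<Sum>k<m. (cmod (f r k))\<^sup>2)"
  by (simp add: mat_trace_def flip: complex_norm_square)

lemma mat_trace_gram_flip: "mat_trace (gram m n (\<lambda>k r. f r k)) = mat_trace (gram n m f)"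
  unfolding mat_trace_gram by (subst sum.swap) simp

lemma psd_trace:
  assumes "psd d A"
  shows "mat_trace A = complex_of_real (Re (mat_trace A))" "0 \<le> Re (mat_trace A)"
  using psd_imp_gram[OF assms] by (auto simp: mat_trace_gram intro!: sum_nonneg)

text \<open>The trace of a Gram matrix is the squared Hilbert-Schmidt norm of its factor, so it
  vanishes only if the factor does.\<close>

lemma psd_trace_zero:
  assumes "psd d A" "mat_trace A = 0"
  shows "A = 0\<^sub>m d d"
proof -
  obtain f where f: "A = gram d d f" using psd_imp_gram[OF assms(1)] by blast
  have "(\<Sum>r<d. \<Sum>k<d. (cmod (f r k))\<^sup>2) = 0"
    using assms(2) unfolding f mat_trace_gram of_real_eq_0_iff .
  then have "\<forall>r<d. (\<Sum>k<d. (cmod (f r k))\<^sup>2) = 0"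
    by (subst (asm) sum_nonneg_eq_0_iff) (auto intro: sum_nonneg)
  then have "\<forall>r<d. \<forall>k<d. f r k = 0"
    by (simp add: sum_nonneg_eq_0_iff)
  then show ?thesis unfolding f by (intro eq_matI) auto
qed

lemma density_normalize:
  assumes "psd d A" "mat_trace A \<noteq> 0"
  shows "density_op d (complex_of_real (1 / Re (mat_trace A)) \<cdot>\<^sub>m A)"
proof -
  have "Re (mat_trace A) \<noteq> 0" using assms psd_trace(1) by (metis of_real_0)
  then have "complex_of_real (1 / Re (mat_trace A)) * mat_trace A = 1"
    by (subst (2) psd_trace(1)[OF assms(1)]) (simp flip: of_real_mult)
  moreover have "psd d (complex_of_real (1 / Re (mat_trace A)) \<cdot>\<^sub>m A)"
    using assms psd_trace(2) by (intro psd_smult) auto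
  ultimately show ?thesis
    using psd_carrier[OF assms(1)] assms(2) by (simp add: density_op_def)
qed

section \<open>The homogeneous extension of the entropy\<close>

text \<open>Extends \<open>S\<close> to all positive semidefinite operators as a function that is homogeneous of degree 1,
  so that concavity becomes superadditivity and conditional states need not be normalised.\<close>

definition hom_entropy :: "(complex mat \<Rightarrow> real) \<Rightarrow> complex mat \<Rightarrow> real" where
  "hom_entropy S A = (if mat_trace A = 0 then 0
     else Re (mat_trace A) * S (complex_of_real (1 / Re (mat_trace A)) \<cdot>\<^sub>m A))"

lemma hom_entropy_density: "density_op d A \<Longrightarrow> hom_entropy S A = S A"
proof -
  have "1 \<cdot>\<^sub>m A = A" for A :: "complex mat" by (intro eq_matI) auto
  then show "density_op d A \<Longrightarrow> hom_entropy S A = S A"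
    by (simp add: hom_entropy_def density_op_def)
qed

lemma hom_entropy_zero [simp]: "hom_entropy S (0\<^sub>m d d) = 0"
  by (simp add: hom_entropy_def mat_trace_def)

text \<open>A positive scalar cancels in the normalised state and survives only in the trace. For
  scalar or trace zero both sides take the default value 0.\<close>

lemma hom_entropy_smult:
  assumes "psd d A" "0 \<le> c"
  shows "hom_entropy S (complex_of_real c \<cdot>\<^sub>m A) = c * hom_entropy S A"
proof (cases "c = 0 \<or> mat_trace A = 0")
  case False
  have "complex_of_real (1 / (c * t)) \<cdot>\<^sub>m (complex_of_real c \<cdot>\<^sub>m A) = complex_of_real (1 / t) \<cdot>\<^sub>m A" for t
    using False by (intro eq_matI) auto
  then show ?thesis using False psd_carrier[OF assms(1)] by (simp add: hom_entropy_def)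
qed (use psd_carrier[OF assms(1)] in \<open>auto simp: hom_entropy_def\<close>)

section \<open>Spectral invariance, purity and superadditivity of the extended entropy\<close>

locale spectral_entropy =
  fixes S :: "complex mat \<Rightarrow> real"
  assumes pure: "entropy_function S"
    and spectral: "depends_on_nonzero_spectrum S"
    and concave: "concave_entropy S"
begin

abbreviation T where "T \<equiv> hom_entropy S"

text \<open>The two Gram matrices have equal traces, so one rescaling of \<open>f\<close> normalises
  both, and the resulting density operators have the same non-zero spectrum.\<close>

lemma hom_entropy_gram_flip: "T (gram m n (\<lambda>k r. f r k)) = T (gram n m f)"
proof (cases "mat_trace (gram n m f) = 0")
  case False
  note tr = mat_trace_gram_flip[of m n f]
  define t where "t = Re (mat_trace (gram n m f))"
  define g where "g r k = complex_of_real (sqrt (1 / t)) * f r k" for r k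
  have t: "0 \<le> 1 / t" using psd_trace(2)[OF psd_gram] by (simp add: t_def)
  have eq: "complex_of_real (1 / t) \<cdot>\<^sub>m gram n m f = gram n m g"
    "complex_of_real (1 / t) \<cdot>\<^sub>m gram m n (\<lambda>k r. f r k) = gram m n (\<lambda>k r. g r k)"
    unfolding g_def by (rule smult_gram[OF t])+
  have "density_op n (gram n m g)"
    using density_normalize[OF psd_gram False] by (simp add: eq(1)[symmetric] t_def)
  moreover have "density_op m (gram m n (\<lambda>k r. g r k))"
    using density_normalize[of m "gram m n (\<lambda>k r. f r k)"] False
    by (simp add: eq(2)[symmetric] t_def tr)
  ultimately have "S (gram n m g) = S (gram m n (\<lambda>k r. g r k))"
    using spectral same_nonzero_spectrum_gram[of n m g] unfolding depends_on_nonzero_spectrum_def by blast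
  then show ?thesis using False eq by (simp add: hom_entropy_def tr t_def)
qed (simp add: hom_entropy_def mat_trace_gram_flip[of m n f])

lemma entropy_gram_flip:
  assumes "density_op n (gram n m f)"
  shows "S (gram m n (\<lambda>k r. f r k)) = S (gram n m f)"
proof -
  have "density_op m (gram m n (\<lambda>k r. f r k))"
    using assms by (simp add: density_op_def mat_trace_gram_flip[of m n f])
  then show ?thesis
    using hom_entropy_gram_flip[of m n f] assms by (simp add: hom_entropy_density)
qed

text \<open>A one-column Gram matrix is zero or a multiple of a pure state, which has zero entropy
  by the normalisation of \<open>S\<close>.\<close>

lemma hom_entropy_gram_one: "T (gram n 1 f) = 0"
proof (cases "mat_trace (gram n 1 f) = 0")
  case False
  define t where "t = Re (mat_trace (gram n 1 f))"
  define g where "g r k = complex_of_real (sqrt (1 / t)) * f r k" for r k :: nat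
  have t: "0 \<le> 1 / t" using psd_trace(2)[OF psd_gram] by (simp add: t_def)
  have eq: "complex_of_real (1 / t) \<cdot>\<^sub>m gram n 1 f = gram n 1 g"
    unfolding g_def by (rule smult_gram[OF t])
  have "density_op n (gram n 1 g)"
    using density_normalize[OF psd_gram False] by (simp only: eq[symmetric] t_def)
  then have "mat_trace (gram n 1 g) = 1" by (simp add: density_op_def)
  moreover have "vec n (\<lambda>r. g r 0) \<bullet>c vec n (\<lambda>r. g r 0) = mat_trace (gram n 1 g)"
    by (simp add: mat_trace_def scalar_prod_def lessThan_atLeast0)
  ultimately have "pure_state n (gram n 1 g)"
    unfolding pure_state_def unit_ket_def gram_one_eq_ketbra by (intro exI conjI refl) auto
  then have "S (gram n 1 g) = 0" using pure by (auto simp: entropy_function_def)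
  then show ?thesis using eq by (simp add: hom_entropy_def t_def)
qed (simp add: hom_entropy_def)

lemma hom_entropy_ketbra: "T (ketbra v) = 0"
  using hom_entropy_gram_one by (metis ketbra_eq_gram carrier_vec_dim_vec)

text \<open>Concavity for the two normalised operators, with weights proportional to their traces.
  Operators of trace zero are set aside first, since \<open>concave_entropy\<close> speaks of
  weights strictly between 0 and 1.\<close>

lemma hom_entropy_add_ge:
  assumes A: "psd d A" and B: "psd d B"
  shows "T A + T B \<le> T (A + B)"
proof (cases "mat_trace A = 0 \<or> mat_trace B = 0")
  case True
  then show ?thesis
    using psd_trace_zero[OF A] psd_trace_zero[OF B] psd_carrier[OF A] psd_carrier[OF B] by auto
next
  case False
  note cA = psd_carrier[OF A] and cB = psd_carrier[OF B]
  define a b where "a = Re (mat_trace A)" and "b = Re (mat_trace B)"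
  have ta: "mat_trace A = complex_of_real a" and tb: "mat_trace B = complex_of_real b"
    using psd_trace(1)[OF A] psd_trace(1)[OF B] by (simp_all add: a_def b_def)
  have ab: "0 < a" "0 < b" using psd_trace(2)[OF A] psd_trace(2)[OF B] False ta tb
    by (auto simp: a_def[symmetric] b_def[symmetric] less_le)
  define \<rho> where "\<rho> j = (if j = 0 then complex_of_real (1 / a) \<cdot>\<^sub>m A else complex_of_real (1 / b) \<cdot>\<^sub>m B)"
    for j :: nat
  define p where "p j = (if j = 0 then a / (a + b) else b / (a + b))" for j :: nat
  have "\<forall>j<2. density_op d (\<rho> j) \<and> 0 < p j \<and> p j < 1"
    using density_normalize[OF A] density_normalize[OF B] False ab
    by (auto simp: \<rho>_def p_def a_def b_def)
  moreover have "(\<Sum>j<2. p j) = 1"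
    using ab by (simp add: p_def eval_nat_numeral add_divide_distrib[symmetric])
  ultimately have "(\<Sum>j<2. p j * S (\<rho> j))
      \<le> S (mat_sum d {..<2} (\<lambda>j. complex_of_real (p j) \<cdot>\<^sub>m \<rho> j))"
    using concave unfolding concave_entropy_def by blast
  moreover have "mat_sum d {..<2} (\<lambda>j. complex_of_real (p j) \<cdot>\<^sub>m \<rho> j) = complex_of_real (1 / (a + b)) \<cdot>\<^sub>m (A + B)"
    using cA cB ab
    by (intro eq_matI) (auto simp: eval_nat_numeral p_def \<rho>_def field_simps simp flip: of_real_add)
  ultimately have "(a + b) * (\<Sum>j<2. p j * S (\<rho> j)) \<le> (a + b) * S (complex_of_real (1 / (a + b)) \<cdot>\<^sub>m (A + B))"
    using ab by simp
  moreover have "(a + b) * (\<Sum>j<2. p j * S (\<rho> j)) = T A + T B"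
  proof -
    have "(a + b) * (p 0 * x) = a * x" "(a + b) * (p (Suc 0) * x) = b * x" for x
      using ab by (simp_all add: p_def)
    note p = this
    show ?thesis
      using ab by (simp add: p eval_nat_numeral \<rho>_def hom_entropy_def ta tb distrib_left)
  qed
  moreover have "T (A + B) = (a + b) * S (complex_of_real (1 / (a + b)) \<cdot>\<^sub>m (A + B))"
    using ab by (simp add: hom_entropy_def mat_trace_add[OF cA cB] ta tb flip: of_real_add)
  ultimately show ?thesis by simp
qed

lemma hom_entropy_sum_ge:
  assumes "finite J" "\<And>j. j \<in> J \<Longrightarrow> psd d (A j)"
  shows "(\<Sum>j\<in>J. T (A j)) \<le> T (mat_sum d J A)"
  using assms
proof (induction J)
  case (insert j J)
  have "(\<Sum>j\<in>insert j J. T (A j)) \<le> T (A j) + T (mat_sum d J A)" using insert by simp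
  also have "\<dots> \<le> T (A j + mat_sum d J A)"
    using insert.prems by (intro hom_entropy_add_ge[where d = d] psd_mat_sum) auto
  finally show ?case using insert by (simp add: mat_sum_insert psd_carrier)
qed (simp add: mat_sum_empty)

end

section \<open>Measurements on the first factor\<close>

text \<open>The unnormalised conditional state on the second factor.\<close>

definition effect_op :: "nat \<Rightarrow> nat \<Rightarrow> complex mat \<Rightarrow> complex mat \<Rightarrow> complex mat" where
  "effect_op da db Q \<rho> = ptrace_fst da db (tensor_mat Q (1\<^sub>m db) * \<rho>)"

lemma effect_op_carrier [simp]: "effect_op da db Q \<rho> \<in> carrier_mat db db"
  and dim_effect_op [simp]: "dim_row (effect_op da db Q \<rho>) = db" "dim_col (effect_op da db Q \<rho>) = db"
  by (auto simp: effect_op_def ptrace_fst_def)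

lemma index_effect_op:
  assumes "Q \<in> carrier_mat da da" "\<rho> \<in> carrier_mat (da * db) (da * db)" "r < db" "s < db"
  shows "effect_op da db Q \<rho> $$ (r, s) =
    (\<Sum>i<da. \<Sum>k<da. Q $$ (i, k) * \<rho> $$ (k * db + r, i * db + s))"
proof -
  have "(tensor_mat Q (1\<^sub>m db) * \<rho>) $$ (i * db + r, i * db + s) =
     (\<Sum>k<da. Q $$ (i, k) * \<rho> $$ (k * db + r, i * db + s))" if "i < da" for i
  proof -
    note b = mult_add_less_mult[OF that assms(3)] mult_add_less_mult[OF that assms(4)]
    have "(tensor_mat Q (1\<^sub>m db) * \<rho>) $$ (i * db + r, i * db + s) =
       (\<Sum>x<da * db. Q $$ (i, x div db) * (if r = x mod db then 1 else 0) * \<rho> $$ (x, i * db + s))"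
      using assms b by (auto simp: tensor_mat_def scalar_prod_def lessThan_atLeast0 intro!: sum.cong)
    \<comment> \<open>Splitting \<open>x\<close> into its two components, the identity factor keeps
      only the summands whose second component is \<open>r\<close>.\<close>
    also have "\<dots> = (\<Sum>k<da. \<Sum>j<db. if r = j then Q $$ (i, k) * \<rho> $$ (k * db + r, i * db + s) else 0)"
      unfolding sum_lessThan_mult by (intro sum.cong refl) auto
    finally show ?thesis using assms(3) by simp
  qed
  then show ?thesis using assms(3,4) by (simp add: effect_op_def ptrace_fst_def)
qed

text \<open>Identifies the normalising trace in \<open>hom_entropy\<close> with the outcome
  probability, which is defined through the marginal on the first factor.\<close>

lemma mat_trace_effect_op:
  assumes "Q \<in> carrier_mat da da" "\<rho> \<in> carrier_mat (da * db) (da * db)"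
  shows "mat_trace (effect_op da db Q \<rho>) = mat_trace (Q * ptrace_snd da db \<rho>)"
proof -
  have "mat_trace (effect_op da db Q \<rho>) =
      (\<Sum>r<db. \<Sum>i<da. \<Sum>k<da. Q $$ (i, k) * \<rho> $$ (k * db + r, i * db + r))"
    by (simp add: mat_trace_def index_effect_op[OF assms])
  also have "\<dots> = (\<Sum>i<da. \<Sum>k<da. \<Sum>r<db. Q $$ (i, k) * \<rho> $$ (k * db + r, i * db + r))"
    by (subst sum.swap, subst sum.swap[of _ "{..<db}"]) simp
  also have "\<dots> = mat_trace (Q * ptrace_snd da db \<rho>)"
    using assms(1)
    by (auto simp: mat_trace_def ptrace_snd_def scalar_prod_def lessThan_atLeast0 sum_distrib_left
      intro!: sum.cong)
  finally show ?thesis .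
qed

lemma effect_op_one:
  assumes "\<rho> \<in> carrier_mat (da * db) (da * db)"
  shows "effect_op da db (1\<^sub>m da) \<rho> = ptrace_fst da db \<rho>"
proof (intro eq_matI)
  fix r s assume "r < dim_row (ptrace_fst da db \<rho>)" "s < dim_col (ptrace_fst da db \<rho>)"
  then have rs: "r < db" "s < db" by (auto simp: ptrace_fst_def)
  have "(\<Sum>k<da. 1\<^sub>m da $$ (i, k) * \<rho> $$ (k * db + r, i * db + s)) =
     (\<Sum>k<da. if i = k then \<rho> $$ (k * db + r, i * db + s) else 0)" if "i < da" for i
    using that by (intro sum.cong) auto
  then show "effect_op da db (1\<^sub>m da) \<rho> $$ (r, s) = ptrace_fst da db \<rho> $$ (r, s)"
    using rs by (simp add: index_effect_op[OF _ assms] ptrace_fst_def)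
qed (simp_all add: ptrace_fst_def)

lemma effect_op_mat_sum:
  assumes "\<And>j. j \<in> J \<Longrightarrow> Q j \<in> carrier_mat da da" "\<rho> \<in> carrier_mat (da * db) (da * db)"
  shows "effect_op da db (mat_sum da J Q) \<rho> = mat_sum db J (\<lambda>j. effect_op da db (Q j) \<rho>)"
proof (intro eq_matI)
  fix r s assume "r < dim_row (mat_sum db J (\<lambda>j. effect_op da db (Q j) \<rho>))"
    "s < dim_col (mat_sum db J (\<lambda>j. effect_op da db (Q j) \<rho>))"
  then have rs: "r < db" "s < db" by auto
  have "effect_op da db (mat_sum da J Q) \<rho> $$ (r, s) =
     (\<Sum>i<da. \<Sum>k<da. \<Sum>j\<in>J. Q j $$ (i, k) * \<rho> $$ (k * db + r, i * db + s))"
    using rs by (simp add: index_effect_op[OF _ assms(2)] sum_distrib_right)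
  also have "\<dots> = (\<Sum>j\<in>J. \<Sum>i<da. \<Sum>k<da. Q j $$ (i, k) * \<rho> $$ (k * db + r, i * db + s))"
    by (subst sum.swap[of _ J], subst sum.swap[of _ J]) simp
  also have "\<dots> = mat_sum db J (\<lambda>j. effect_op da db (Q j) \<rho>) $$ (r, s)"
    using rs by (simp add: index_effect_op[OF assms(1) assms(2)])
  finally show "effect_op da db (mat_sum da J Q) \<rho> $$ (r, s) =
    mat_sum db J (\<lambda>j. effect_op da db (Q j) \<rho>) $$ (r, s)" .
qed simp_all

text \<open>A rank-1 effect contracts the first index of the factor with the conjugate of
  \<open>v\<close> and leaves the columns alone. The conditional state is thus a Gram matrix over
  the same purifying index, ready to be flipped.\<close>

lemma effect_op_ketbra_gram:
  assumes "v \<in> carrier_vec da"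
  shows "effect_op da db (ketbra v) (gram (da * db) m f) =
    gram db m (\<lambda>r c. \<Sum>k<da. cnj (v $ k) * f (k * db + r) c)"
proof (intro eq_matI)
  fix r s assume "r < dim_row (gram db m (\<lambda>r c. \<Sum>k<da. cnj (v $ k) * f (k * db + r) c))"
    "s < dim_col (gram db m (\<lambda>r c. \<Sum>k<da. cnj (v $ k) * f (k * db + r) c))"
  then have rs: "r < db" "s < db" by auto
  have "effect_op da db (ketbra v) (gram (da * db) m f) $$ (r, s) =
     (\<Sum>i<da. \<Sum>k<da. \<Sum>c<m. (cnj (v $ k) * f (k * db + r) c) * (v $ i * cnj (f (i * db + s) c)))"
    using rs assms mult_add_less_mult[of _ da _ db]
    by (simp add: index_effect_op sum_distrib_left ac_simps)
  also have "\<dots> = (\<Sum>c<m. \<Sum>k<da. \<Sum>i<da. (cnj (v $ k) * f (k * db + r) c) * (v $ i * cnj (f (i * db + s) c)))"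
    by (subst sum.swap[of _ "{..<m}"], subst sum.swap[of _ "{..<m}"], subst sum.swap) simp
  also have "\<dots> = (\<Sum>c<m. (\<Sum>k<da. cnj (v $ k) * f (k * db + r) c) *
      cnj (\<Sum>k<da. cnj (v $ k) * f (k * db + s) c))"
    by (simp add: sum_product)
  finally show "effect_op da db (ketbra v) (gram (da * db) m f) $$ (r, s) =
      gram db m (\<lambda>r c. \<Sum>k<da. cnj (v $ k) * f (k * db + r) c) $$ (r, s)"
    using rs by simp
qed simp_all

lemma psd_effect_op:
  assumes "psd da Q" "psd (da * db) \<rho>"
  shows "psd db (effect_op da db Q \<rho>)"
proof -
  obtain f g where "Q = gram da da f" and \<rho>: "\<rho> = gram (da * db) (da * db) g"
    using psd_imp_gram assms by blast
  then have Q: "Q = mat_sum da {..<da} (\<lambda>k. ketbra (vec da (\<lambda>r. f r k)))"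
    by (simp add: gram_eq_sum_ketbra)
  have "effect_op da db Q \<rho> = mat_sum db {..<da} (\<lambda>k. effect_op da db (ketbra (vec da (\<lambda>r. f r k))) \<rho>)"
    unfolding Q \<rho> by (intro effect_op_mat_sum) auto
  then show ?thesis by (simp add: \<rho> effect_op_ketbra_gram psd_mat_sum)
qed

lemma povm_sum_effect_op:
  assumes "povm da m P" "\<rho> \<in> carrier_mat (da * db) (da * db)"
  shows "mat_sum db {..<m} (\<lambda>j. effect_op da db (P j) \<rho>) = ptrace_fst da db \<rho>"
proof -
  have "effect_op da db (mat_sum da {..<m} P) \<rho> = mat_sum db {..<m} (\<lambda>j. effect_op da db (P j) \<rho>)"
    using assms by (intro effect_op_mat_sum) (auto simp: povm_def psd_carrier)
  then show ?thesis using assms by (simp add: povm_def effect_op_one)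
qed

text \<open>The outcome probabilities are absorbed by homogeneity, and the unnormalised conditional
  states add up to the second marginal because the effects add up to the identity.\<close>

lemma chi_povm_eq:
  assumes P: "povm da m P" and \<rho>: "psd (da * db) \<rho>"
  shows "chi_povm S da db m P \<rho> =
    S (ptrace_fst da db \<rho>) - (\<Sum>j<m. hom_entropy S (effect_op da db (P j) \<rho>))"
proof -
  define E where "E j = effect_op da db (P j) \<rho>" for j
  define J where "J = {j. j < m \<and> outcome_prob da db (P j) \<rho> \<noteq> 0}"
  have J: "J \<subseteq> {..<m}" "finite J" by (auto simp: J_def)
  have E: "psd db (E j)" if "j < m" for j
    using P \<rho> that by (auto simp: E_def povm_def intro: psd_effect_op)
  have pr: "outcome_prob da db (P j) \<rho> = Re (mat_trace (E j))" if "j < m" for j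
    using P that psd_carrier[OF \<rho>]
    by (simp add: outcome_prob_def E_def mat_trace_effect_op povm_def psd_carrier)
  have tr0: "mat_trace (E j) = 0 \<longleftrightarrow> Re (mat_trace (E j)) = 0" if "j < m" for j
    using psd_trace(1)[OF E[OF that]] by (metis of_real_0 zero_complex.simps(1))
  \<comment> \<open>An omitted outcome has an unnormalised state of trace zero, hence zero, so
    summing over all outcomes changes neither sum.\<close>
  have E0: "E j = 0\<^sub>m db db" if "j \<in> {..<m} - J" for j
    using that pr E tr0 by (auto simp: J_def intro!: psd_trace_zero)
  have scaled: "complex_of_real (outcome_prob da db (P j) \<rho>) \<cdot>\<^sub>m cond_state da db (P j) \<rho> = E j"
    if "j \<in> J" for j
    using that unfolding cond_state_def effect_op_def[symmetric] E_def[symmetric]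
    by (intro eq_matI) (auto simp: J_def E_def)
  have ent: "outcome_prob da db (P j) \<rho> * S (cond_state da db (P j) \<rho>) = hom_entropy S (E j)"
    if "j \<in> J" for j
    using that pr[of j] tr0[of j]
    unfolding cond_state_def effect_op_def[symmetric] E_def[symmetric]
    by (simp add: J_def hom_entropy_def)
  have "mat_sum db J (\<lambda>j. complex_of_real (outcome_prob da db (P j) \<rho>) \<cdot>\<^sub>m cond_state da db (P j) \<rho>)
      = mat_sum db {..<m} E"
  proof (intro eq_matI)
    fix r s assume "r < dim_row (mat_sum db {..<m} E)" "s < dim_col (mat_sum db {..<m} E)"
    then have rs: "r < db" "s < db" by auto
    have "(\<Sum>j\<in>J. E j $$ (r, s)) = (\<Sum>j<m. E j $$ (r, s))"
      using J E0 rs by (intro sum.mono_neutral_left) auto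
    then show "mat_sum db J (\<lambda>j. complex_of_real (outcome_prob da db (P j) \<rho>) \<cdot>\<^sub>m cond_state da db (P j) \<rho>) $$ (r, s)
      = mat_sum db {..<m} E $$ (r, s)"
      using rs by (simp add: scaled cong: sum.cong)
  qed simp_all
  moreover have "(\<Sum>j\<in>J. hom_entropy S (E j)) = (\<Sum>j<m. hom_entropy S (E j))"
    using J E0 by (intro sum.mono_neutral_left) auto
  ultimately show ?thesis
    using povm_sum_effect_op[OF P psd_carrier[OF \<rho>]] ent
    by (simp add: chi_povm_def holevo_def J_def[symmetric] E_def[symmetric] cong: sum.cong)
qed

section \<open>Rank-1 effects\<close>

lemma det_carrier_mat_2:
  assumes "A \<in> carrier_mat 2 2"
  shows "det A = A $$ (0, 0) * A $$ (1, 1) - A $$ (0, 1) * A $$ (1, 0)"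
proof -
  have d: "mat_delete A 0 0 \<in> carrier_mat 1 1" "mat_delete A 0 1 \<in> carrier_mat 1 1"
    using mat_delete_carrier[OF assms] by simp_all
  show ?thesis
    using assms laplace_expansion_row[OF assms, of 0]
    by (simp add: eval_nat_numeral cofactor_def det_single d[unfolded One_nat_def] mat_delete_def)
qed

lemma rank_pos:
  assumes A: "A \<in> carrier_mat n m" and "i < n" "j < m" and nz: "A $$ (i, j) \<noteq> (0 :: 'a :: field)"
  shows "1 \<le> vec_space.rank n A"
proof -
  have I: "{a. a < n \<and> a \<in> {i}} = {i}" "{a. a < m \<and> a \<in> {j}} = {j}"
    "{a \<in> {i}. a < i} = {}" "{a \<in> {j}. a < j} = {}"
    using assms by auto
  have "submatrix A {i} {j} \<in> carrier_mat 1 1"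
    using A I by (intro carrier_matI) (simp_all add: dim_submatrix)
  moreover have "submatrix A {i} {j} $$ (0, 0) = A $$ (i, j)"
    using submatrix_index_card[of i A j "{i}" "{j}", unfolded I] assms by simp
  ultimately have "det (submatrix A {i} {j}) \<noteq> 0" using nz by (simp add: det_single)
  from vec_space.rank_gt_minor[OF A this] I show ?thesis by simp
qed

text \<open>All 2 by 2 minors vanish when the rank is at most 1. Since \<open>submatrix\<close>
  lists indices in increasing order, ordered index pairs come first and the other orders follow by
  symmetry.\<close>

lemma minor_eq_if_rank_le_1:
  fixes A :: "'a :: field mat"
  assumes A: "A \<in> carrier_mat n m" and "vec_space.rank n A \<le> 1"
    and "i < n" "r < n" "j < m" "s < m"
  shows "A $$ (i, j) * A $$ (r, s) = A $$ (i, s) * A $$ (r, j)"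
proof -
  have minor: "A $$ (i, j) * A $$ (r, s) = A $$ (i, s) * A $$ (r, j)"
    if "i < r" "r < n" "j < s" "s < m" for i j r s
  proof -
    have I: "{a. a < n \<and> a \<in> {i, r}} = {i, r}" "{a. a < m \<and> a \<in> {j, s}} = {j, s}"
      "{a \<in> {i, r}. a < i} = {}" "{a \<in> {j, s}. a < j} = {}"
      "{a \<in> {i, r}. a < r} = {i}" "{a \<in> {j, s}. a < s} = {j}"
      using that by auto
    let ?B = "submatrix A {i, r} {j, s}"
    have "?B \<in> carrier_mat 2 2"
      using A I that by (intro carrier_matI) (simp_all add: dim_submatrix)
    moreover have "?B $$ (0, 0) = A $$ (i, j)" "?B $$ (0, 1) = A $$ (i, s)"
      "?B $$ (1, 0) = A $$ (r, j)" "?B $$ (1, 1) = A $$ (r, s)"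
      using submatrix_index_card[of i A j "{i, r}" "{j, s}", unfolded I] submatrix_index_card[of i A s "{i, r}" "{j, s}", unfolded I]
        submatrix_index_card[of r A j "{i, r}" "{j, s}", unfolded I] submatrix_index_card[of r A s "{i, r}" "{j, s}", unfolded I]
        A that by simp_all
    moreover have "det ?B = 0"
    proof (rule ccontr)
      assume "det ?B \<noteq> 0"
      from vec_space.rank_gt_minor[OF A this] I assms(2) that show False by simp
    qed
    ultimately show ?thesis using det_carrier_mat_2[of ?B] by simp
  qed
  have "?thesis" if "i \<noteq> r" "j \<noteq> s"
    using minor[of i r j s] minor[of i r s j] minor[of r i j s] minor[of r i s j] that assms(3-6)
    by (metis mult.commute linorder_neqE_nat)
  then show ?thesis by (cases "i = r"; cases "j = s") (simp_all add: mult.commute)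
qed

lemma rank_ketbra:
  assumes v: "v \<in> carrier_vec d" and "v \<noteq> 0\<^sub>v d"
  shows "vec_space.rank d (ketbra v) = 1"
proof -
  have "vec_space.rank d (ketbra v) \<le> 1"
    using v by (intro vec_space.rank_le_1_product_entries[where f = "\<lambda>r. v $ r" and g = "\<lambda>s. cnj (v $ s)" and nc = d]) auto
  moreover obtain i where i: "i < d" "v $ i \<noteq> 0"
    using assms by (metis carrier_vecD eq_vecI index_zero_vec(1) index_zero_vec(2))
  have "1 \<le> vec_space.rank d (ketbra v)"
    using i v by (intro rank_pos[of _ d d i i]) auto
  ultimately show ?thesis by simp
qed

text \<open>A non-zero positive semidefinite matrix has a non-zero diagonal entry
  \<open>A $$ (i, i)\<close>. Column \<open>i\<close> divided by the square root of that entry is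
  the required vector: vanishing minors determine every other entry from this column.\<close>

lemma rank_one_psd:
  assumes A: "psd d A" and rank: "vec_space.rank d A = 1"
  shows "\<exists>v. v \<in> carrier_vec d \<and> A = ketbra v"
proof -
  obtain f where f: "A = gram d d f" using psd_imp_gram[OF A] by blast
  have diag: "A $$ (i, i) = complex_of_real (\<Sum>k<d. (cmod (f i k))\<^sup>2)" if "i < d" for i
    using that by (simp add: f flip: complex_norm_square)
  have herm: "A $$ (s, r) = cnj (A $$ (r, s))" if "r < d" "s < d" for r s
    using that by (simp add: f mult.commute)
  have "\<exists>i<d. A $$ (i, i) \<noteq> 0"
  proof (rule ccontr)
    assume "\<not> (\<exists>i<d. A $$ (i, i) \<noteq> 0)"
    then have "A = 0\<^sub>m d d"
      using psd_carrier[OF A] by (intro psd_trace_zero[OF A]) (simp add: mat_trace_def)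
    then show False using rank vec_space.rank_0I[where 'a = complex] by simp
  qed
  then obtain i where i: "i < d" "A $$ (i, i) \<noteq> 0" by blast
  define q where "q = sqrt (\<Sum>k<d. (cmod (f i k))\<^sup>2)"
  have q: "complex_of_real q * complex_of_real q = A $$ (i, i)"
    by (simp add: q_def diag i sum_nonneg flip: of_real_mult)
  then have q0: "q \<noteq> 0" using i by auto
  define v where "v = vec d (\<lambda>r. A $$ (r, i) / q)"
  have "A $$ (r, s) = ketbra v $$ (r, s)" if "r < d" "s < d" for r s
  proof -
    have "A $$ (r, s) * A $$ (i, i) = A $$ (r, i) * cnj (A $$ (s, i))"
      using minor_eq_if_rank_le_1[of A d d r i s i] psd_carrier[OF A] rank that i herm[of s i]
      by simp
    then show ?thesis using that i q q0 by (simp add: v_def field_simps)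
  qed
  then have "A = ketbra v" using psd_carrier[OF A] by (intro eq_matI) (auto simp: v_def)
  moreover have "v \<in> carrier_vec d" by (simp add: v_def)
  ultimately show ?thesis by blast
qed

section \<open>Partial traces and channels\<close>

lemma ptrace_fst_carrier [simp]: "ptrace_fst da db X \<in> carrier_mat db db"
  and dim_ptrace_fst [simp]: "dim_row (ptrace_fst da db X) = db" "dim_col (ptrace_fst da db X) = db"
  and index_ptrace_fst [simp]: "r < db \<Longrightarrow> s < db \<Longrightarrow>
    ptrace_fst da db X $$ (r, s) = (\<Sum>i<da. X $$ (i * db + r, i * db + s))"
  and ptrace_snd_carrier [simp]: "ptrace_snd da db X \<in> carrier_mat da da"
  and dim_ptrace_snd [simp]: "dim_row (ptrace_snd da db X) = da" "dim_col (ptrace_snd da db X) = da"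
  and index_ptrace_snd [simp]: "r' < da \<Longrightarrow> s' < da \<Longrightarrow>
    ptrace_snd da db X $$ (r', s') = (\<Sum>j<db. X $$ (r' * db + j, s' * db + j))"
  by (auto simp: ptrace_fst_def ptrace_snd_def)

text \<open>Tracing out a factor moves its index from the rows of the Gram factor to the columns:
  the discarded system joins the purifying one.\<close>

lemma ptrace_fst_gram:
  "ptrace_fst da db (gram (da * db) m f) =
   gram db (da * m) (\<lambda>r x. f ((x div m) * db + r) (x mod m))"
  by (intro eq_matI) (auto simp: mult_add_less_mult sum_lessThan_mult)

lemma ptrace_snd_gram:
  "ptrace_snd da db (gram (da * db) m f) =
   gram da (db * m) (\<lambda>r x. f (r * db + x div m) (x mod m))"
  by (intro eq_matI) (auto simp: mult_add_less_mult sum_lessThan_mult)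

lemma mat_trace_ptrace_fst:
  "X \<in> carrier_mat (da * db) (da * db) \<Longrightarrow> mat_trace (ptrace_fst da db X) = mat_trace X"
  by (simp add: mat_trace_def sum_lessThan_mult sum.swap[of _ "{..<db}"])

lemma mat_trace_ptrace_snd:
  "X \<in> carrier_mat (da * db) (da * db) \<Longrightarrow> mat_trace (ptrace_snd da db X) = mat_trace X"
  by (simp add: mat_trace_def sum_lessThan_mult)

lemma psd_ptrace_fst: "psd (da * db) X \<Longrightarrow> psd db (ptrace_fst da db X)"
  and psd_ptrace_snd: "psd (da * db) X \<Longrightarrow> psd da (ptrace_snd da db X)"
  by (auto dest!: psd_imp_gram simp: ptrace_fst_gram ptrace_snd_gram)

lemma density_ptrace_fst: "density_op (da * db) X \<Longrightarrow> density_op db (ptrace_fst da db X)"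
  and density_ptrace_snd: "density_op (da * db) X \<Longrightarrow> density_op da (ptrace_snd da db X)"
  by (auto simp: density_op_def psd_ptrace_fst psd_ptrace_snd mat_trace_ptrace_fst
      mat_trace_ptrace_snd psd_carrier)

lemma ptrace_snd_smult:
  "A \<in> carrier_mat (da * db) (da * db) \<Longrightarrow> ptrace_snd da db (c \<cdot>\<^sub>m A) = c \<cdot>\<^sub>m ptrace_snd da db A"
  by (intro eq_matI) (auto simp: mult_add_less_mult sum_distrib_left)

lemma ptrace_snd_add:
  "A \<in> carrier_mat (da * db) (da * db) \<Longrightarrow> B \<in> carrier_mat (da * db) (da * db) \<Longrightarrow>
   ptrace_snd da db (A + B) = ptrace_snd da db A + ptrace_snd da db B"
  by (intro eq_matI) (auto simp: mult_add_less_mult sum.distrib)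

text \<open>Measuring the first system commutes with discarding the third: the two operations sum
  over different components of the index.\<close>

lemma ptrace_snd_effect_op:
  assumes "Q \<in> carrier_mat da da" "\<rho> \<in> carrier_mat (da * db * dc) (da * db * dc)"
  shows "ptrace_snd db dc (effect_op da (db * dc) Q \<rho>) =
    effect_op da db Q (ptrace_snd (da * db) dc \<rho>)"
proof (intro eq_matI)
  fix r s
  assume "r < dim_row (effect_op da db Q (ptrace_snd (da * db) dc \<rho>))"
    "s < dim_col (effect_op da db Q (ptrace_snd (da * db) dc \<rho>))"
  then have rs: "r < db" "s < db" by auto
  have \<rho>: "\<rho> \<in> carrier_mat (da * (db * dc)) (da * (db * dc))" using assms(2) by (simp add: mult.assoc)
  have idx: "i * (db * dc) + (t * dc + j) = (i * db + t) * dc + j" for i t j by (simp add: algebra_simps)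
  have "ptrace_snd db dc (effect_op da (db * dc) Q \<rho>) $$ (r, s) =
    (\<Sum>j<dc. \<Sum>i<da. \<Sum>k<da. Q $$ (i, k) * \<rho> $$ ((k * db + r) * dc + j, (i * db + s) * dc + j))"
    using rs by (simp add: index_effect_op[OF assms(1) \<rho>] mult_add_less_mult idx)
  also have "\<dots> = (\<Sum>i<da. \<Sum>k<da. \<Sum>j<dc. Q $$ (i, k) * \<rho> $$ ((k * db + r) * dc + j, (i * db + s) * dc + j))"
    by (subst sum.swap, subst sum.swap[of _ "{..<dc}"]) simp
  also have "\<dots> = effect_op da db Q (ptrace_snd (da * db) dc \<rho>) $$ (r, s)"
    using rs by (simp add: index_effect_op[OF assms(1)] mult_add_less_mult sum_distrib_left)
  finally show "ptrace_snd db dc (effect_op da (db * dc) Q \<rho>) $$ (r, s) =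
    effect_op da db Q (ptrace_snd (da * db) dc \<rho>) $$ (r, s)" .
qed auto

section \<open>Pure states, rank-1 effects and elementary channels\<close>

lemma density_ketbra: "unit_ket d v \<Longrightarrow> density_op d (ketbra v)"
  by (auto simp: density_op_def unit_ket_def psd_ketbra mat_trace_def scalar_prod_def lessThan_atLeast0)

text \<open>For \<open>v = 0\<close> any unit vector serves, with weight 0. Outcomes of probability
  zero can therefore stay in an ensemble of pure states, which keeps the index set
  \<open>{..<m}\<close>.\<close>

lemma ketbra_normalize:
  assumes "v \<in> carrier_vec d" "0 < d"
  shows "\<exists>u. unit_ket d u \<and> ketbra v = complex_of_real (Re (mat_trace (ketbra v))) \<cdot>\<^sub>m ketbra u"
proof (cases "mat_trace (ketbra v) = 0")
  case True
  have "unit_vec d 0 \<bullet>c unit_vec d 0 = (1 :: complex)"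
    using assms(2) by (simp add: scalar_prod_def lessThan_atLeast0 if_distrib cong: if_cong)
  then have "unit_ket d (unit_vec d 0)" by (simp add: unit_ket_def)
  moreover have "ketbra v = 0 \<cdot>\<^sub>m ketbra (unit_vec d 0)"
    unfolding psd_trace_zero[OF psd_ketbra[OF assms(1)] True] by (intro eq_matI) auto
  ultimately show ?thesis using True by auto
next
  case False
  define t where "t = Re (mat_trace (ketbra v))"
  have t: "mat_trace (ketbra v) = complex_of_real t" "0 \<le> t"
    using psd_trace[OF psd_ketbra[OF assms(1)]] by (simp_all add: t_def)
  define u where "u = complex_of_real (1 / sqrt t) \<cdot>\<^sub>v v"
  have u: "ketbra u = complex_of_real (1 / t) \<cdot>\<^sub>m ketbra v"
  proof -
    have "complex_of_real (sqrt t) * complex_of_real (sqrt t) = complex_of_real t"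
      using t(2) by (simp flip: of_real_mult)
    then show ?thesis by (intro eq_matI) (auto simp: u_def)
  qed
  have "u \<in> carrier_vec d" using assms(1) by (simp add: u_def)
  moreover have "u \<bullet>c u = mat_trace (ketbra u)"
    by (simp add: mat_trace_def scalar_prod_def lessThan_atLeast0)
  moreover have "mat_trace (ketbra u) = 1"
    unfolding u using False assms(1) t(1) by (simp add: mat_trace_smult[OF ketbra_carrier])
  ultimately have "unit_ket d u" by (simp add: unit_ket_def)
  moreover have "ketbra v = complex_of_real t \<cdot>\<^sub>m ketbra u"
    unfolding u using False t(1) by (intro eq_matI) auto
  ultimately show ?thesis by (auto simp: t_def)
qed

lemma rank1_povm_obtain:
  assumes "rank1_povm d m N"
  obtains v where "\<And>j. j < m \<Longrightarrow> v j \<in> carrier_vec d" "\<And>j. j < m \<Longrightarrow> N j = ketbra (v j)"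
proof -
  have "\<forall>j\<in>{..<m}. \<exists>v. v \<in> carrier_vec d \<and> N j = ketbra v"
    using assms by (auto simp: rank1_povm_def povm_def intro: rank_one_psd)
  from bchoice[OF this] show ?thesis using that by blast
qed

text \<open>Associativity of the index convention makes each ampliation of this partial trace a
  partial trace of the same kind on a larger first factor, so complete positivity reduces to
  positivity.\<close>

lemma quantum_channel_ptrace_snd: "quantum_channel (db * dc) db (ptrace_snd db dc)"
proof -
  have "ampliation k (db * dc) db (ptrace_snd db dc) X = ptrace_snd (k * db) dc X"
    if "X \<in> carrier_mat (k * (db * dc)) (k * (db * dc))" for k X
  proof (intro eq_matI)
    fix r s assume "r < dim_row (ptrace_snd (k * db) dc X)" "s < dim_col (ptrace_snd (k * db) dc X)"
    then have rs: "r < k * db" "s < k * db" by auto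
    then have db: "0 < db" by (cases db) auto
    have idx: "(t div db) * (db * dc) + ((t mod db) * dc + j) = t * dc + j" for t j
    proof -
      have "(t div db) * (db * dc) + ((t mod db) * dc + j) = (t div db * db + t mod db) * dc + j"
        by (simp only: add_mult_distrib mult.assoc add.assoc)
      then show ?thesis by simp
    qed
    show "ampliation k (db * dc) db (ptrace_snd db dc) X $$ (r, s) = ptrace_snd (k * db) dc X $$ (r, s)"
      using rs db by (simp add: ampliation_def mat_block_def mult_add_less_mult idx)
  qed (simp_all add: ampliation_def)
  then have "completely_positive (db * dc) db (ptrace_snd db dc)"
    by (auto simp: completely_positive_def psd_carrier psd_ptrace_snd mult.assoc)
  then show ?thesis
    by (auto simp: quantum_channel_def linear_on_mats_def trace_preserving_def ptrace_snd_add
        ptrace_snd_smult mat_trace_ptrace_snd)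
qed

lemma psd_channel:
  assumes "quantum_channel d d' \<E>" "psd d A"
  shows "psd d' (\<E> A)"
proof -
  have "\<E> A \<in> carrier_mat d' d'"
    using assms by (auto simp: quantum_channel_def linear_on_mats_def psd_carrier)
  moreover have "mat_block d A 0 0 = A"
    using psd_carrier[OF assms(2)] by (intro eq_matI) (auto simp: mat_block_def)
  \<comment> \<open>Plain positivity is the case \<open>k = 1\<close> of complete
    positivity.\<close>
  ultimately have "ampliation 1 d d' \<E> A = \<E> A"
    by (intro eq_matI) (auto simp: ampliation_def)
  then show ?thesis
    using assms unfolding quantum_channel_def completely_positive_def by (metis mult_1)
qed

section \<open>The equivalences\<close>

context spectral_entropy
begin

text \<open>Each effect is split into the ketbras of the columns of its Gram factor. Zero columns
  are dropped, as they do not have rank 1, and \<open>h\<close> renumbers the rest. The refinement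
  is chosen before \<open>db\<close> and the state.\<close>

lemma povm_refine:
  assumes P: "povm da m P"
  obtains m' N where "rank1_povm da m' N"
    "\<And>db \<rho>. psd (da * db) \<rho> \<Longrightarrow> chi_povm S da db m P \<rho> \<le> chi_povm S da db m' N \<rho>"
proof -
  have "\<forall>j\<in>{..<m}. \<exists>f. P j = gram da da f"
    using P by (auto simp: povm_def intro: psd_imp_gram)
  from bchoice[OF this] obtain f where f: "P j = gram da da (f j)" if "j < m" for j by blast
  define v where "v x = vec da (\<lambda>r. f (fst x) r (snd x))" for x
  have v: "v x \<in> carrier_vec da" for x by (simp add: v_def)
  define B where "B = {..<m} \<times> {..<da}"
  define K where "K = {x \<in> B. v x \<noteq> 0\<^sub>v da}"
  have K: "K \<subseteq> B" "finite B" "finite K" by (auto simp: K_def B_def)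
  obtain h where h: "bij_betw h {..<card K} K"
    using ex_bij_betw_nat_finite[OF K(3)] by (auto simp: lessThan_atLeast0)
  define N where "N i = ketbra (v (h i))" for i
  have Pj: "P j = mat_sum da {..<da} (\<lambda>k. ketbra (v (j, k)))" if "j < m" for j
    using f[OF that] by (simp add: gram_eq_sum_ketbra v_def)
  have zero: "ketbra (v x) = 0\<^sub>m da da" if "x \<in> B - K" for x
    using that by (intro eq_matI) (auto simp: K_def)
  \<comment> \<open>Stated for arbitrary \<open>F\<close> vanishing at zero because it is used
    twice: for matrix entries, to check completeness of \<open>N\<close>, and for entropies of
    conditional states.\<close>
  have sums: "(\<Sum>i<card K. F (N i)) = (\<Sum>j<m. \<Sum>k<da. F (ketbra (v (j, k))))"
    if "F (0\<^sub>m da da) = 0" for F :: "complex mat \<Rightarrow> 'x :: comm_monoid_add"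
  proof -
    have "(\<Sum>i<card K. F (N i)) = (\<Sum>x\<in>K. F (ketbra (v x)))"
      unfolding N_def by (rule sum.reindex_bij_betw[OF h])
    also have "\<dots> = (\<Sum>x\<in>B. F (ketbra (v x)))"
      using K zero that by (intro sum.mono_neutral_left) auto
    finally show ?thesis by (simp add: B_def sum.cartesian_product)
  qed
  have "mat_sum da {..<card K} N = mat_sum da {..<m} P"
  proof (intro eq_matI)
    fix r s assume "r < dim_row (mat_sum da {..<m} P)" "s < dim_col (mat_sum da {..<m} P)"
    then have rs: "r < da" "s < da" by auto
    then show "mat_sum da {..<card K} N $$ (r, s) = mat_sum da {..<m} P $$ (r, s)"
      using sums[of "\<lambda>A. A $$ (r, s)"] by (simp add: Pj del: index_ketbra)
  qed auto
  moreover have "h i \<in> K" if "i < card K" for i using bij_betwE[OF h] that by auto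
  ultimately have N: "rank1_povm da (card K) N"
    using P by (auto simp: rank1_povm_def povm_def N_def K_def v intro!: psd_ketbra rank_ketbra[unfolded One_nat_def])
  have "chi_povm S da db m P \<rho> \<le> chi_povm S da db (card K) N \<rho>" if \<rho>: "psd (da * db) \<rho>" for db \<rho>
  proof -
    let ?E = "\<lambda>Q. effect_op da db Q \<rho>"
    have c: "\<rho> \<in> carrier_mat (da * db) (da * db)" by (rule psd_carrier[OF \<rho>])
    have "?E (0\<^sub>m da da) = 0\<^sub>m db db"
      by (intro eq_matI) (auto simp: index_effect_op[OF _ c])
    then have "(\<Sum>i<card K. T (?E (N i))) = (\<Sum>j<m. \<Sum>k<da. T (?E (ketbra (v (j, k)))))"
      using sums[of "\<lambda>Q. T (?E Q)"] by simp
    \<comment> \<open>Superadditivity within each original effect; these sums enter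
      \<open>chi_povm\<close> with a minus sign, so the refinement raises it.\<close>
    also have "\<dots> \<le> (\<Sum>j<m. T (?E (P j)))"
    proof (intro sum_mono)
      fix j assume "j \<in> {..<m}"
      then have "?E (P j) = mat_sum db {..<da} (\<lambda>k. ?E (ketbra (v (j, k))))"
        using Pj v c by (simp add: effect_op_mat_sum)
      then show "(\<Sum>k<da. T (?E (ketbra (v (j, k))))) \<le> T (?E (P j))"
        using v \<rho> by (auto intro!: hom_entropy_sum_ge psd_effect_op psd_ketbra)
    qed
    finally show ?thesis using N P \<rho> by (simp add: chi_povm_eq rank1_povm_def)
  qed
  with N show ?thesis using that by blast
qed

text \<open>Read \<open>f\<close> as the amplitudes of a pure state on three systems;
  \<open>\<rho>'\<close> is its marginal on the first and third. Every claim about entropies is then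
  a flip of one factor, also after a rank-1 effect on the first system.\<close>

lemma complementary_state:
  assumes "density_op (da * db) \<rho>"
  obtains dc \<rho>' where "density_op (da * dc) \<rho>'"
    "ptrace_snd da dc \<rho>' = ptrace_snd da db \<rho>"
    "S (ptrace_fst da dc \<rho>') = S \<rho>"
    "S \<rho>' = S (ptrace_fst da db \<rho>)"
    "\<And>v. v \<in> carrier_vec da \<Longrightarrow>
      T (effect_op da dc (ketbra v) \<rho>') = T (effect_op da db (ketbra v) \<rho>)"
proof -
  define M where "M = da * db"
  obtain f where f: "\<rho> = gram (da * db) M f"
    using assms psd_imp_gram by (auto simp: density_op_def M_def)
  \<comment> \<open>The columns of \<open>f\<close> index the purifying system \<open>c\<close>, of dimension \<open>M\<close>; \<open>g\<close> exchanges the roles of \<open>b\<close> and \<open>c\<close>.\<close>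
  define g where "g x j = f ((x div M) * db + j) (x mod M)" for x j
  define \<rho>' where "\<rho>' = gram (da * M) db g"
  have \<rho>b: "ptrace_fst da db \<rho> = gram db (da * M) (\<lambda>j x. g x j)"
    unfolding f g_def by (rule ptrace_fst_gram)
  \<comment> \<open>Its trace is that of its flip, the second marginal of
    \<open>\<rho>\<close>.\<close>
  have dens: "density_op (da * M) \<rho>'"
    using density_ptrace_fst[OF assms] mat_trace_gram_flip[of db "da * M" g]
    unfolding \<rho>b by (simp add: density_op_def \<rho>'_def)
  have "ptrace_snd da M \<rho>' = ptrace_snd da db \<rho>"
    unfolding \<rho>'_def f
    by (intro eq_matI) (auto simp: mult_add_less_mult g_def sum.swap[of _ "{..<M}"])
  moreover have "S (ptrace_fst da M \<rho>') = S \<rho>"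
  proof -
    have "ptrace_fst da M \<rho>' = gram M (da * db) (\<lambda>c x. f x c)"
      unfolding \<rho>'_def ptrace_fst_gram by (intro gram_cong) (simp add: g_def)
    then show ?thesis using entropy_gram_flip[of "da * db" M f] assms f by simp
  qed
  moreover have "S \<rho>' = S (ptrace_fst da db \<rho>)"
    using entropy_gram_flip[of "da * M" db g] dens by (simp add: \<rho>b \<rho>'_def)
  moreover have "T (effect_op da M (ketbra v) \<rho>') = T (effect_op da db (ketbra v) \<rho>)"
    if "v \<in> carrier_vec da" for v
  proof -
    have "effect_op da M (ketbra v) \<rho>' = gram M db (\<lambda>c r. \<Sum>k<da. cnj (v $ k) * f (k * db + r) c)"
      unfolding \<rho>'_def effect_op_ketbra_gram[OF that] by (intro gram_cong) (simp add: g_def)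
    note eq = this
    show ?thesis
      unfolding eq f effect_op_ketbra_gram[OF that] by (rule hom_entropy_gram_flip)
  qed
  ultimately show ?thesis using that dens by blast
qed

text \<open>Both differences equal minus the sum of the conditional entropies, which is the same for
  the two complementary systems.\<close>

lemma chi_povm_complement:
  assumes \<rho>: "density_op (da * db) \<rho>"
  obtains dc \<rho>' where "density_op (da * dc) \<rho>'"
    "ptrace_snd da dc \<rho>' = ptrace_snd da db \<rho>"
    "S (ptrace_fst da dc \<rho>') = S \<rho>"
    "S \<rho>' = S (ptrace_fst da db \<rho>)"
    "\<And>m N. rank1_povm da m N \<Longrightarrow>
      chi_povm S da dc m N \<rho>' - S \<rho> = chi_povm S da db m N \<rho> - S \<rho>'"
proof -
  from complementary_state[OF \<rho>] obtain dc \<rho>' where *: "density_op (da * dc) \<rho>'"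
    "ptrace_snd da dc \<rho>' = ptrace_snd da db \<rho>"
    "S (ptrace_fst da dc \<rho>') = S \<rho>"
    "S \<rho>' = S (ptrace_fst da db \<rho>)"
    "\<And>v. v \<in> carrier_vec da \<Longrightarrow>
      T (effect_op da dc (ketbra v) \<rho>') = T (effect_op da db (ketbra v) \<rho>)" by blast
  have "chi_povm S da dc m N \<rho>' - S \<rho> = chi_povm S da db m N \<rho> - S \<rho>'"
    if N: "rank1_povm da m N" for m N
  proof -
    obtain v where "\<And>j. j < m \<Longrightarrow> v j \<in> carrier_vec da" "\<And>j. j < m \<Longrightarrow> N j = ketbra (v j)"
      using rank1_povm_obtain[OF N] by blast
    then have "(\<Sum>j<m. T (effect_op da dc (N j) \<rho>')) = (\<Sum>j<m. T (effect_op da db (N j) \<rho>))"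
      using *(5) by (intro sum.cong) auto
    then show ?thesis
      using N \<rho> * by (simp add: chi_povm_eq rank1_povm_def density_op_def)
  qed
  with * show ?thesis using that by blast
qed

text \<open>The right-hand side of the inequality does not mention the POVM, so raising the
  left-hand side by refinement is harmless.\<close>

lemma holevo_le_measured_entropy_iff_rank1:
  "holevo_le_measured_entropy S \<longleftrightarrow>
    (\<forall>da db m \<rho> N. density_op (da * db) \<rho> \<and> rank1_povm da m N \<longrightarrow>
      chi_povm S da db m N \<rho> \<le> S (ptrace_snd da db \<rho>))" (is "?L \<longleftrightarrow> ?R")
proof
  assume ?R
  show ?L
    unfolding holevo_le_measured_entropy_def
  proof safe
    fix da db m \<rho> P assume "density_op (da * db) \<rho>" "povm da m P"
    moreover from povm_refine[OF this(2)] obtain m' N where "rank1_povm da m' N"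
      "\<And>db \<rho>. psd (da * db) \<rho> \<Longrightarrow> chi_povm S da db m P \<rho> \<le> chi_povm S da db m' N \<rho>" by blast
    ultimately show "chi_povm S da db m P \<rho> \<le> S (ptrace_snd da db \<rho>)"
      using \<open>?R\<close> unfolding density_op_def by (meson order_trans)
  qed
qed (auto simp: holevo_le_measured_entropy_def rank1_povm_def)

lemma firmly_subadditive_iff_rank1:
  "firmly_subadditive S \<longleftrightarrow>
    (\<forall>da db m \<rho> N. density_op (da * db) \<rho> \<and> rank1_povm da m N \<longrightarrow>
      chi_povm S da db m N \<rho> \<le> mutual_info S da db \<rho>)" (is "?L \<longleftrightarrow> ?R")
proof
  assume ?R
  show ?L
    unfolding firmly_subadditive_def
  proof safe
    fix da db m \<rho> P assume "density_op (da * db) \<rho>" "povm da m P"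
    moreover from povm_refine[OF this(2)] obtain m' N where "rank1_povm da m' N"
      "\<And>db \<rho>. psd (da * db) \<rho> \<Longrightarrow> chi_povm S da db m P \<rho> \<le> chi_povm S da db m' N \<rho>" by blast
    ultimately show "chi_povm S da db m P \<rho> \<le> mutual_info S da db \<rho>"
      using \<open>?R\<close> unfolding density_op_def by (meson order_trans)
  qed
qed (auto simp: firmly_subadditive_def rank1_povm_def)

text \<open>In both directions the hypothesis is applied to the complementary state
  \<open>\<rho>'\<close>. Passing to it adds \<open>S \<rho> - S \<rho>'\<close> to
  \<open>chi_povm\<close>, and this is exactly the amount by which the two upper bounds
  differ.\<close>

lemma firmly_subadditive_iff_holevo_le_measured_entropy:
  "firmly_subadditive S \<longleftrightarrow> holevo_le_measured_entropy S"
  unfolding holevo_le_measured_entropy_iff_rank1 firmly_subadditive_iff_rank1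
proof (intro iffI allI impI; elim conjE)
  fix da db m \<rho> N
  assume sub: "\<forall>da db m \<rho> N. density_op (da * db) \<rho> \<and> rank1_povm da m N \<longrightarrow>
      chi_povm S da db m N \<rho> \<le> mutual_info S da db \<rho>"
    and \<rho>: "density_op (da * db) \<rho>" and N: "rank1_povm da m N"
  from chi_povm_complement[OF \<rho>] obtain dc \<rho>' where *: "density_op (da * dc) \<rho>'"
    "ptrace_snd da dc \<rho>' = ptrace_snd da db \<rho>" "S (ptrace_fst da dc \<rho>') = S \<rho>"
    "S \<rho>' = S (ptrace_fst da db \<rho>)"
    "chi_povm S da dc m N \<rho>' - S \<rho> = chi_povm S da db m N \<rho> - S \<rho>'" using N by metis
  have "chi_povm S da dc m N \<rho>' \<le> mutual_info S da dc \<rho>'" using sub *(1) N by blast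
  then show "chi_povm S da db m N \<rho> \<le> S (ptrace_snd da db \<rho>)"
    using * by (simp add: mutual_info_def)
next
  fix da db m \<rho> N
  assume le: "\<forall>da db m \<rho> N. density_op (da * db) \<rho> \<and> rank1_povm da m N \<longrightarrow>
      chi_povm S da db m N \<rho> \<le> S (ptrace_snd da db \<rho>)"
    and \<rho>: "density_op (da * db) \<rho>" and N: "rank1_povm da m N"
  from chi_povm_complement[OF \<rho>] obtain dc \<rho>' where *: "density_op (da * dc) \<rho>'"
    "ptrace_snd da dc \<rho>' = ptrace_snd da db \<rho>" "S (ptrace_fst da dc \<rho>') = S \<rho>"
    "S \<rho>' = S (ptrace_fst da db \<rho>)"
    "chi_povm S da dc m N \<rho>' - S \<rho> = chi_povm S da db m N \<rho> - S \<rho>'" using N by metis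
  have "chi_povm S da dc m N \<rho>' \<le> S (ptrace_snd da dc \<rho>')" using le *(1) N by blast
  then show "chi_povm S da db m N \<rho> \<le> mutual_info S da db \<rho>"
    using * by (simp add: mutual_info_def)
qed

lemma chi_povm_pure:
  assumes \<psi>: "unit_ket (da * db * dc) \<psi>" and N: "rank1_povm da m N"
  shows "chi_povm S da (db * dc) m N (ketbra \<psi>) =
    S (ptrace_snd da db (ptrace_snd (da * db) dc (ketbra \<psi>)))"
proof -
  define f where "f = (\<lambda>x (_ :: nat). \<psi> $ x)"
  have c: "\<psi> \<in> carrier_vec (da * db * dc)" using \<psi> by (simp add: unit_ket_def)
  have k: "ketbra \<psi> = gram (da * db * dc) 1 f" and k': "ketbra \<psi> = gram (da * (db * dc)) 1 f"
    using ketbra_eq_gram[OF c] by (simp_all add: f_def mult.assoc)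
  have dens: "density_op (da * (db * dc)) (ketbra \<psi>)"
    using density_ketbra[OF \<psi>] by (simp add: mult.assoc)
  obtain v where v: "\<And>j. j < m \<Longrightarrow> v j \<in> carrier_vec da" "\<And>j. j < m \<Longrightarrow> N j = ketbra (v j)"
    using rank1_povm_obtain[OF N] by blast
  have "T (effect_op da (db * dc) (N j) (ketbra \<psi>)) = 0" if "j < m" for j
    unfolding v(2)[OF that] k' effect_op_ketbra_gram[OF v(1)[OF that]] by (rule hom_entropy_gram_one)
  then have "chi_povm S da (db * dc) m N (ketbra \<psi>) = S (ptrace_fst da (db * dc) (ketbra \<psi>))"
    using N dens by (simp add: chi_povm_eq rank1_povm_def density_op_def)
  also have "ptrace_fst da (db * dc) (ketbra \<psi>) = gram (db * dc) da (\<lambda>y i. \<psi> $ (i * (db * dc) + y))"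
    unfolding k' ptrace_fst_gram by (simp add: f_def)
  \<comment> \<open>The columns of this factor are indexed by the first system, so the flip turns
    the marginal on the last two systems into the marginal on the first.\<close>
  also have "S \<dots> = S (gram da (db * dc) (\<lambda>i y. \<psi> $ (i * (db * dc) + y)))"
    using density_ptrace_fst[OF dens] calculation
    by (intro entropy_gram_flip[symmetric]) (simp add: k' ptrace_fst_gram f_def)
  also have "gram da (db * dc) (\<lambda>i y. \<psi> $ (i * (db * dc) + y)) =
      ptrace_snd da db (ptrace_snd (da * db) dc (ketbra \<psi>))"
  proof -
    have idx: "(i * db + y div dc) * dc + y mod dc = i * (db * dc) + y" for i y
      by (simp add: add_mult_distrib mult.assoc add.assoc)
    show ?thesis unfolding k ptrace_snd_gram by (simp add: f_def idx)
  qed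
  finally show ?thesis .
qed

text \<open>By \<open>chi_povm_pure\<close> the two inequalities coincide for the bipartite
  marginals of pure tripartite states, and every bipartite state is such a marginal.\<close>

lemma holevo_le_measured_entropy_iff_tripartite:
  "holevo_le_measured_entropy S \<longleftrightarrow> holevo_tripartite_monotone S"
proof
  assume le: "holevo_le_measured_entropy S"
  show "holevo_tripartite_monotone S"
    unfolding holevo_tripartite_monotone_def pure_state_def
  proof safe
    fix da db dc m N \<psi>
    assume \<psi>: "unit_ket (da * db * dc) \<psi>" and N: "rank1_povm da m N"
    have "density_op (da * db) (ptrace_snd (da * db) dc (ketbra \<psi>))"
      using \<psi> by (intro density_ptrace_snd density_ketbra)
    then show "chi_povm S da db m N (ptrace_snd (da * db) dc (ketbra \<psi>))
        \<le> chi_povm S da (db * dc) m N (ketbra \<psi>)"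
      using le N unfolding chi_povm_pure[OF \<psi> N]
      by (simp add: holevo_le_measured_entropy_def rank1_povm_def)
  qed
next
  assume mono: "holevo_tripartite_monotone S"
  show "holevo_le_measured_entropy S"
    unfolding holevo_le_measured_entropy_iff_rank1
  proof safe
    fix da db m \<rho> N assume \<rho>: "density_op (da * db) \<rho>" and N: "rank1_povm da m N"
    define M where "M = da * db"
    obtain f where f: "\<rho> = gram (da * db) M f"
      using \<rho> psd_imp_gram by (auto simp: density_op_def M_def)
    \<comment> \<open>A purification of \<open>\<rho>\<close>: the columns of its Gram factor become
      a third system of dimension \<open>M\<close>.\<close>
    define \<psi> where "\<psi> = vec (da * db * M) (\<lambda>x. f (x div M) (x mod M))"
    have c: "\<psi> \<in> carrier_vec (da * db * M)" by (simp add: \<psi>_def)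
    have tr: "ptrace_snd (da * db) M (ketbra \<psi>) = \<rho>"
      unfolding f by (intro eq_matI) (auto simp: \<psi>_def mult_add_less_mult)
    have "\<psi> \<bullet>c \<psi> = mat_trace (ketbra \<psi>)"
      by (simp add: mat_trace_def scalar_prod_def lessThan_atLeast0)
    also have "\<dots> = 1"
      using mat_trace_ptrace_snd[of "ketbra \<psi>" "da * db" M] c \<rho> tr by (simp add: density_op_def)
    finally have \<psi>: "unit_ket (da * db * M) \<psi>" using c by (simp add: unit_ket_def)
    then have "pure_state (da * db * M) (ketbra \<psi>)" by (auto simp: pure_state_def)
    then have "chi_povm S da db m N (ptrace_snd (da * db) M (ketbra \<psi>))
        \<le> chi_povm S da (db * M) m N (ketbra \<psi>)"
      using mono N unfolding holevo_tripartite_monotone_def by blast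
    then show "chi_povm S da db m N \<rho> \<le> S (ptrace_snd da db \<rho>)"
      by (simp add: chi_povm_pure[OF \<psi> N] tr)
  qed
qed

text \<open>A rank-1 measurement leaves the last two systems in pure states. The channel inequality
  is applied to this ensemble, with the partial trace over the third system as channel.\<close>

lemma holevo_channel_imp_tripartite:
  assumes mono: "holevo_channel_monotone S"
  shows "holevo_tripartite_monotone S"
  unfolding holevo_tripartite_monotone_def pure_state_def
proof safe
  fix da db dc m N \<psi>
  assume \<psi>: "unit_ket (da * db * dc) \<psi>" and N: "rank1_povm da m N"
  let ?\<rho> = "ketbra \<psi>" and ?\<rho>b = "ptrace_snd (da * db) dc (ketbra \<psi>)"
  have \<psi>c: "\<psi> \<in> carrier_vec (da * db * dc)" using \<psi> by (simp add: unit_ket_def)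
  have \<rho>: "density_op (da * (db * dc)) ?\<rho>" using density_ketbra[OF \<psi>] by (simp add: mult.assoc)
  have \<rho>c: "?\<rho> \<in> carrier_mat (da * (db * dc)) (da * (db * dc))"
    using \<rho> by (simp add: density_op_def psd_carrier)
  have \<rho>b: "density_op (da * db) ?\<rho>b" using density_ketbra[OF \<psi>] by (rule density_ptrace_snd)
  have P: "povm da m N" and Nc: "\<And>j. j < m \<Longrightarrow> N j \<in> carrier_mat da da"
    using N by (auto simp: rank1_povm_def povm_def psd_carrier)
  \<comment> \<open>An operator of trace 1 cannot live in dimension 0; this provides the unit
    vectors for outcomes of probability zero.\<close>
  have pos: "0 < db * dc"
    using \<rho> by (cases "db * dc = 0") (auto simp: density_op_def mat_trace_def psd_def)
  obtain v where v: "\<And>j. j < m \<Longrightarrow> v j \<in> carrier_vec da" "\<And>j. j < m \<Longrightarrow> N j = ketbra (v j)"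
    using rank1_povm_obtain[OF N] by blast
  \<comment> \<open>The unnormalised vector left on the last two systems after outcome
    \<open>j\<close>.\<close>
  define \<phi> where "\<phi> j = vec (db * dc) (\<lambda>r. \<Sum>k<da. cnj (v j $ k) * \<psi> $ (k * (db * dc) + r))" for j
  have \<phi>: "effect_op da (db * dc) (N j) ?\<rho> = ketbra (\<phi> j)" if "j < m" for j
    using \<psi>c v[OF that] effect_op_ketbra_gram[of "v j" da "db * dc" 1 "\<lambda>x _. \<psi> $ x"]
    by (simp add: ketbra_eq_gram[of \<psi> "da * (db * dc)"] mult.assoc \<phi>_def gram_one_eq_ketbra[unfolded One_nat_def])
  define p where "p j = Re (mat_trace (ketbra (\<phi> j)))" for j
  have "\<forall>j. \<exists>u. unit_ket (db * dc) u \<and> ketbra (\<phi> j) = complex_of_real (p j) \<cdot>\<^sub>m ketbra u"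
    unfolding p_def using pos by (intro allI ketbra_normalize) (simp add: \<phi>_def)
  then obtain u where u: "\<And>j. unit_ket (db * dc) (u j)"
    "\<And>j. ketbra (\<phi> j) = complex_of_real (p j) \<cdot>\<^sub>m ketbra (u j)" by metis
  have uc: "ketbra (u j) \<in> carrier_mat (db * dc) (db * dc)" for j
    using u(1) by (simp add: unit_ket_def)
  have p0: "0 \<le> p j" for j
    unfolding p_def by (intro psd_trace(2)[OF psd_ketbra]) (simp add: \<phi>_def)
  have sum: "mat_sum (db * dc) {..<m} (\<lambda>j. complex_of_real (p j) \<cdot>\<^sub>m ketbra (u j))
      = ptrace_fst da (db * dc) ?\<rho>"
    unfolding povm_sum_effect_op[OF P \<rho>c, symmetric]
    by (rule mat_sum_cong) (simp_all add: \<phi> u(2)[symmetric])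
  have "(\<Sum>j<m. p j) = 1"
  proof -
    have "mat_trace (ptrace_fst da (db * dc) ?\<rho>) = (\<Sum>j<m. complex_of_real (p j) * mat_trace (ketbra (u j)))"
      unfolding sum[symmetric] using uc
      by (simp add: mat_trace_mat_sum mat_trace_smult[OF uc])
    then have "complex_of_real (\<Sum>j<m. p j) = 1"
      using density_ptrace_fst[OF \<rho>] density_ketbra[OF u(1)] by (simp add: density_op_def)
    then show ?thesis by (metis of_real_eq_1_iff)
  qed
  then have "holevo S db {..<m} p (\<lambda>j. ptrace_snd db dc (ketbra (u j)))
      \<le> holevo S (db * dc) {..<m} p (\<lambda>j. ketbra (u j))"
    using mono quantum_channel_ptrace_snd[of db dc] p0 u(1)
    unfolding holevo_channel_monotone_def prob_weights_def by blast
  also have "holevo S (db * dc) {..<m} p (\<lambda>j. ketbra (u j)) = S (ptrace_fst da (db * dc) ?\<rho>)"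
  proof -
    have "S (ketbra (u j)) = 0" for j
      using hom_entropy_density[OF density_ketbra[OF u(1)], of S] hom_entropy_ketbra by metis
    then show ?thesis by (simp add: holevo_def sum)
  qed
  also have "\<dots> = chi_povm S da (db * dc) m N ?\<rho>"
    using \<rho> P by (simp add: chi_povm_eq density_op_def \<phi> hom_entropy_ketbra)
  also have "holevo S db {..<m} p (\<lambda>j. ptrace_snd db dc (ketbra (u j))) = chi_povm S da db m N ?\<rho>b"
  proof -
    have scaled: "complex_of_real (p j) \<cdot>\<^sub>m ptrace_snd db dc (ketbra (u j)) = effect_op da db (N j) ?\<rho>b"
      if "j < m" for j
      using ptrace_snd_effect_op[OF Nc[OF that], of ?\<rho> db dc] \<psi>c
      by (simp add: \<phi>[OF that] u(2) ptrace_snd_smult[OF uc])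
    have "p j * S (ptrace_snd db dc (ketbra (u j))) = T (effect_op da db (N j) ?\<rho>b)"
      if "j < m" for j
    proof -
      have d: "density_op db (ptrace_snd db dc (ketbra (u j)))"
        by (intro density_ptrace_snd density_ketbra u)
      then show ?thesis unfolding scaled[OF that, symmetric]
        using p0 d by (simp add: hom_entropy_smult[of db] hom_entropy_density[OF d] density_op_def)
    qed
    moreover have "mat_sum db {..<m} (\<lambda>j. complex_of_real (p j) \<cdot>\<^sub>m ptrace_snd db dc (ketbra (u j)))
        = ptrace_fst da db ?\<rho>b"
      unfolding povm_sum_effect_op[OF P ptrace_snd_carrier, symmetric]
      by (rule mat_sum_cong) (simp_all add: scaled)
    ultimately show ?thesis
      using P \<rho>b by (simp add: holevo_def chi_povm_eq density_op_def)
  qed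
  finally show "chi_povm S da db m N ?\<rho>b \<le> chi_povm S da (db * dc) m N ?\<rho>" .
qed

lemma holevo_le_measured_entropy_imp_channel:
  assumes le: "holevo_le_measured_entropy S"
  shows "holevo_channel_monotone S"
  unfolding holevo_channel_monotone_def
proof safe
  fix d d' m \<E> p \<psi>
  assume \<E>: "quantum_channel d d' \<E>" and p: "prob_weights m p"
    and \<psi>: "\<forall>j<m. unit_ket d (\<psi> j)"
  have lin: "\<And>A. A \<in> carrier_mat d d \<Longrightarrow> \<E> A \<in> carrier_mat d' d'"
    "\<And>c A. A \<in> carrier_mat d d \<Longrightarrow> \<E> (c \<cdot>\<^sub>m A) = c \<cdot>\<^sub>m \<E> A"
    and tr: "\<And>A. A \<in> carrier_mat d d \<Longrightarrow> mat_trace (\<E> A) = mat_trace A"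
    using \<E> by (auto simp: quantum_channel_def linear_on_mats_def trace_preserving_def)
  have p0: "0 \<le> p j" if "j < m" for j
    using p that by (simp add: prob_weights_def)
  have p1: "(\<Sum>j<m. p j) = 1"
    using p by (simp add: prob_weights_def)
  have kc: "ketbra (\<psi> j) \<in> carrier_mat d d" if "j < m" for j
    using \<psi> that by (simp add: unit_ket_def)
  have dim\<psi>: "dim_vec (\<psi> j) = d" if "j < m" for j
    using \<psi> that by (simp add: unit_ket_def carrier_vecD)
  have dens: "density_op d' (\<E> (ketbra (\<psi> j)))" if "j < m" for j
    using density_ketbra[of d "\<psi> j"] \<psi> that tr[OF kc[OF that]] psd_channel[OF \<E>]
    by (simp add: density_op_def)
  \<comment> \<open>Row \<open>j\<close> is the weighted vector of the ensemble.
    \<open>gram m d g\<close> will be the marginal of \<open>X\<close> on the first factor, and its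
    flip is the average state of the ensemble.\<close>
  define g where "g j r = complex_of_real (sqrt (p j)) * \<psi> j $ r" for j r
  define \<Phi> where "\<Phi> = vec (m * d) (\<lambda>x. g (x div d) (x mod d))"
  define X where "X = ampliation m d d' \<E> (ketbra \<Phi>)"
  have block: "mat_block d (ketbra \<Phi>) i j = mat d d (\<lambda>(r, s). g i r * cnj (g j s))"
    if "i < m" "j < m" for i j
    using that by (intro eq_matI) (auto simp: mat_block_def \<Phi>_def mult_add_less_mult)
  have diag: "mat_block d (ketbra \<Phi>) j j = complex_of_real (p j) \<cdot>\<^sub>m ketbra (\<psi> j)" if "j < m" for j
  proof -
    have "complex_of_real (sqrt (p j)) * complex_of_real (sqrt (p j)) = complex_of_real (p j)"
      using p0[OF that] by (simp flip: of_real_mult)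
    then have "g j r * cnj (g j s) = complex_of_real (p j) * (\<psi> j $ r * cnj (\<psi> j $ s))" for r s
      by (simp add: g_def)
    then show ?thesis
      unfolding block[OF that that] using dim\<psi>[OF that] by (intro eq_matI) auto
  qed
  have blockc: "mat_block d Y i j \<in> carrier_mat d d" for Y i j by (simp add: mat_block_def)
  have X: "X $$ (i * d' + r, j * d' + s) = \<E> (mat_block d (ketbra \<Phi>) i j) $$ (r, s)"
    if "i < m" "j < m" "r < d'" "s < d'" for i j r s
    using that by (simp add: X_def ampliation_def mult_add_less_mult)
  have "psd (m * d) (ketbra \<Phi>)" by (intro psd_ketbra) (simp add: \<Phi>_def)
  then have psdX: "psd (m * d') X"
    using \<E> by (auto simp: X_def quantum_channel_def completely_positive_def)
  then have Xc: "X \<in> carrier_mat (m * d') (m * d')" by (rule psd_carrier)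
  have \<rho>a: "ptrace_snd m d' X = gram m d g"
  \<comment> \<open>Trace preservation is applied to every block, including the off-diagonal ones,
    which need not be positive; their traces are the overlaps of the ensemble vectors.\<close>
  proof (intro eq_matI)
    fix i j assume "i < dim_row (gram m d g)" "j < dim_col (gram m d g)"
    then have ij: "i < m" "j < m" by auto
    have "ptrace_snd m d' X $$ (i, j) = mat_trace (\<E> (mat_block d (ketbra \<Phi>) i j))"
      using ij carrier_matD(1)[OF lin(1)[OF blockc]] by (simp add: mat_trace_def X)
    also have "\<dots> = gram m d g $$ (i, j)"
      by (subst tr[OF blockc]) (use ij in \<open>simp add: block mat_trace_def\<close>)
    finally show "ptrace_snd m d' X $$ (i, j) = gram m d g $$ (i, j)" .
  qed auto
  have average: "mat_sum d {..<m} (\<lambda>j. complex_of_real (p j) \<cdot>\<^sub>m ketbra (\<psi> j)) = gram d m (\<lambda>r j. g j r)"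
  proof (intro eq_matI)
    fix r s assume "r < dim_row (gram d m (\<lambda>r j. g j r))" "s < dim_col (gram d m (\<lambda>r j. g j r))"
    then have rs: "r < d" "s < d" by auto
    have "(complex_of_real (p j) \<cdot>\<^sub>m ketbra (\<psi> j)) $$ (r, s) = g j r * cnj (g j s)" if "j < m" for j
      using rs unfolding diag[OF that, symmetric] block[OF that that] by simp
    then show "mat_sum d {..<m} (\<lambda>j. complex_of_real (p j) \<cdot>\<^sub>m ketbra (\<psi> j)) $$ (r, s)
        = gram d m (\<lambda>r j. g j r) $$ (r, s)"
      using rs by simp
  qed auto
  have "mat_trace (gram m d g) = (\<Sum>j<m. mat_trace (mat_block d (ketbra \<Phi>) j j))"
    by (simp add: block mat_trace_def)
  also have "\<dots> = (\<Sum>j<m. complex_of_real (p j))"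
    using density_ketbra[of d] \<psi>
    by (intro sum.cong) (auto simp: diag density_op_def mat_trace_smult[OF kc])
  also have "\<dots> = 1" using p1 by (simp flip: of_real_sum)
  finally have trg: "mat_trace (gram m d g) = 1" .
  then have densX: "density_op (m * d') X" and densg: "density_op m (gram m d g)"
    using psdX mat_trace_ptrace_snd[OF Xc] by (simp_all add: density_op_def \<rho>a)
  define P where "P j = ketbra (unit_vec m j)" for j :: nat
  have Pc: "P j \<in> carrier_mat m m" for j by (simp add: P_def)
  have P_entry: "P j $$ (a, b) = (if a = j \<and> b = j then 1 else 0)" if "a < m" "b < m" for a b j
    using that by (simp add: P_def unit_vec_def)
  have "mat_sum m {..<m} P = 1\<^sub>m m"
  proof (intro eq_matI)
    fix a b assume "a < dim_row (1\<^sub>m m)" "b < dim_col (1\<^sub>m m)"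
    then have ab: "a < m" "b < m" by auto
    then have "(\<Sum>j<m. P j $$ (a, b)) = (\<Sum>j<m. if a = j then (if b = a then 1 else 0) else 0)"
      by (intro sum.cong) (auto simp: P_entry)
    then show "mat_sum m {..<m} P $$ (a, b) = 1\<^sub>m m $$ (a, b)" using ab by auto
  qed auto
  then have povm: "povm m m P" by (simp add: povm_def P_def psd_ketbra)
  \<comment> \<open>Measuring the first factor in the standard basis selects the diagonal blocks of
    \<open>X\<close>, the weighted channel outputs.\<close>
  have eff: "effect_op m d' (P j) X = complex_of_real (p j) \<cdot>\<^sub>m \<E> (ketbra (\<psi> j))" if "j < m" for j
  proof (intro eq_matI)
    fix r s assume "r < dim_row (complex_of_real (p j) \<cdot>\<^sub>m \<E> (ketbra (\<psi> j)))"
      "s < dim_col (complex_of_real (p j) \<cdot>\<^sub>m \<E> (ketbra (\<psi> j)))"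
    then have rs: "r < d'" "s < d'" using lin(1)[OF kc[OF that]] by auto
    have "effect_op m d' (P j) X $$ (r, s) =
      (\<Sum>a<m. \<Sum>b<m. if b = j then (if a = j then X $$ (j * d' + r, j * d' + s) else 0) else 0)"
      unfolding index_effect_op[OF Pc Xc rs] by (intro sum.cong) (auto simp: P_entry)
    also have "\<dots> = X $$ (j * d' + r, j * d' + s)" using that by simp
    also have "\<dots> = (complex_of_real (p j) \<cdot>\<^sub>m \<E> (ketbra (\<psi> j))) $$ (r, s)"
      using that rs by (simp add: X diag lin(2)[OF kc])
    finally show "effect_op m d' (P j) X $$ (r, s) =
      (complex_of_real (p j) \<cdot>\<^sub>m \<E> (ketbra (\<psi> j))) $$ (r, s)" .
  qed (use lin(1)[OF kc[OF that]] in auto)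
  have "holevo S d' {..<m} p (\<lambda>j. \<E> (ketbra (\<psi> j))) = chi_povm S m d' m P X"
  proof -
    have "T (effect_op m d' (P j) X) = p j * S (\<E> (ketbra (\<psi> j)))" if "j < m" for j
      using dens[OF that] p0[OF that] hom_entropy_density[OF dens[OF that], of S]
      by (simp add: eff[OF that] hom_entropy_smult[of d'] density_op_def)
    moreover have "mat_sum d' {..<m} (\<lambda>j. complex_of_real (p j) \<cdot>\<^sub>m \<E> (ketbra (\<psi> j))) = ptrace_fst m d' X"
      unfolding povm_sum_effect_op[OF povm Xc, symmetric]
      by (rule mat_sum_cong) (simp_all add: eff)
    ultimately show ?thesis
      using chi_povm_eq[OF povm psdX, of S] by (simp add: holevo_def)
  qed
  also have "\<dots> \<le> S (ptrace_snd m d' X)"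
    using le densX povm unfolding holevo_le_measured_entropy_def by blast
  also have "\<dots> = holevo S d {..<m} p (\<lambda>j. ketbra (\<psi> j))"
  proof -
    have "S (ketbra (\<psi> j)) = 0" if "j < m" for j
      using hom_entropy_density[OF density_ketbra, of d "\<psi> j" S] \<psi> that hom_entropy_ketbra by metis
    then have "holevo S d {..<m} p (\<lambda>j. ketbra (\<psi> j)) = S (gram d m (\<lambda>r j. g j r))"
      by (simp add: holevo_def average)
    then show ?thesis using entropy_gram_flip[OF densg] \<rho>a by simp
  qed
  finally show "holevo S d' {..<m} p (\<lambda>j. \<E> (ketbra (\<psi> j))) \<le> holevo S d {..<m} p (\<lambda>j. ketbra (\<psi> j))" .
qed

end

theorem theorem2:
  fixes S :: "complex mat \<Rightarrow> real"
  assumes entropy: "entropy_function S"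
    and spectral: "depends_on_nonzero_spectrum S"
    and concave: "concave_entropy S"
  shows "(firmly_subadditive S \<longleftrightarrow> holevo_le_measured_entropy S) \<and>
         (holevo_le_measured_entropy S \<longleftrightarrow> holevo_tripartite_monotone S) \<and>
         (holevo_tripartite_monotone S \<longleftrightarrow> holevo_channel_monotone S)"
proof -
  interpret spectral_entropy S by unfold_locales fact+
  show ?thesis
    using firmly_subadditive_iff_holevo_le_measured_entropy holevo_le_measured_entropy_iff_tripartite
      holevo_channel_imp_tripartite holevo_le_measured_entropy_imp_channel by blast
qed

end
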